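(* Let $R$ be a commutative unique factorization domain, $\sigma\in\mathrm{Aut}(R)$, $0\ne a\in R$, $A=R(\sigma,a)$ the corresponding generalized Weyl algebra, $\mathsf p$ a divisor of $a$ and $\mathsf q=\sigma(a/\mathsf p)$. The $A$-submodules of $V_{\mathsf p}$ which are cyclic over $R$ are exactly those of the form $\langle g\rangle=Rg$, where $g$ is either $0$ or a product of basic chain products and products of full finite orbits: $$g\sim\Big(\prod_{i=1}^n\mathcal P(\mathsf q_i,\mathsf p_i)\Big)\cdot\Big(\prod_{j=1}^m\prod_{k=1}^{|\mathrm{Orb}(z_j)|}\sigma^k(z_j)\Big)\qquad (n,m\ge 0),$$ where the $\mathcal P(\mathsf q_i,\mathsf p_i)$ are basic chain products with $\mathsf p_i,\mathsf q_i$ irreducible elements such that $\prod_{i=1}^n\mathsf q_i\mid\mathsf q$ and $\prod_{i=1}^n\mathsf p_i\mid\mathsf p$, and where the $z_j$ are irreducible elements of some (not necessarily distinct) finite $\mathcal G$-orbits. Moreover, for each such nonzero $g$ the basic chains may always be chosen so that, for each pair of indices $i,j$, we have $\sigma(\mathsf p_i)\not\sim\mathsf q_j$, and such that $\mathcal P(\mathsf q_i,\mathsf p_i)$ and $\mathcal P(\mathsf q_j,\mathsf p_j)$ are either coprime or one divides the other.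
   Context: Modules are left and unital. The generalized Weyl algebra $R(\sigma,a)$ is the ring generated by $R$, $x$, $y$ subject to $x\sigma(r)=rx$, $yr=\sigma(r)y$ for all $r\in R$, $xy=a$, $yx=\sigma(a)$. For a divisor $\mathsf p$ of $a$ and $\mathsf q=\sigma(a/\mathsf p)$, the $A$-module $V_{\mathsf p}$ is $R$ as an abelian group, with $r'\cdot r=r'r$, $x\cdot r=\sigma^{-1}(r)\mathsf p$, $y\cdot r=\sigma(r)\mathsf q$. Thus $A$-submodules of $V_{\mathsf p}$ are ideals of $R$. Write $r\sim s$ if $r,s\in R$ are associates, $[r]$ for the class of $r$. $\mathcal G=\langle\sigma\rangle\le\mathrm{Aut}(R)$ acts on the set $\mathrm{Irr}(R)$ of classes of irreducible elements; $\mathrm{Orb}(z)=\{[\sigma^k(z)]\mid k\in\mathbb Z\}$. Chain product: if $r,s$ are irreducible and $s\sim\sigma^n(r)$ for some $n\ge0$, with $n$ minimal with this property, then $\mathcal P(r,s)=\prod_{i=0}^n\sigma^i(r)$. A basic chain product (relative to $V_{\mathsf p}$) is a chain product $\mathcal P(\mathsf q_0,\mathsf p_0)=\prod_{i=0}^n\sigma^i(\mathsf q_0)$ where $\mathsf q_0$ is an irreducible factor of $\mathsf q$, $\mathsf p_0\sim\sigma^n(\mathsf q_0)$ is an irreducible factor of $\mathsf p$, $n\ge0$ is the smallest nonnegative integer such that $\mathsf p_0\sim\sigma^n(\mathsf q_0)$ and, in case $\mathrm{Orb}(\mathsf q_0)$ is finite, $n<|\mathrm{Orb}(\mathsf q_0)|-1$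 (so that the chain does not exhaust the whole orbit). *)

theory Defs
  imports "HOL-Algebra.Module" "HOL-Computational_Algebra.Factorial_Ring"
begin

section \<open>Automorphisms, associates and orbits\<close>

text \<open>
  The unique factorization domain is a type of sort \<open>{factorial_semiring, idom}\<close>: an integral domain
  in which every nonzero element is a product of primes up to a unit. The class also carries a
  (total) division and a choice of representatives of the classes of associates; every unique
  factorization domain can be equipped with these, and no result below depends on the choice.
\<close>

definition ring_automorphism :: "('a::comm_ring_1 \<Rightarrow> 'a) \<Rightarrow> bool" where
  "ring_automorphism \<sigma> \<longleftrightarrow> bij \<sigma> \<and> \<sigma> 1 = 1 \<and>
     (\<forall>r s. \<sigma> (r + s) = \<sigma> r + \<sigma> s) \<and> (\<forall>r s. \<sigma> (r * s) = \<sigma> r * \<sigma> s)"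

definition associates :: "'a::comm_monoid_mult \<Rightarrow> 'a \<Rightarrow> bool" where
  "associates r s \<longleftrightarrow> r dvd s \<and> s dvd r"

definition associate_class :: "'a::comm_monoid_mult \<Rightarrow> 'a set" where
  "associate_class r = {s. associates r s}"

definition int_iterate :: "('a \<Rightarrow> 'a) \<Rightarrow> int \<Rightarrow> 'a \<Rightarrow> 'a" where
  "int_iterate \<sigma> k = (if 0 \<le> k then \<sigma> ^^ nat k else (inv_into UNIV \<sigma>) ^^ nat (- k))"

definition Orb :: "('a::comm_monoid_mult \<Rightarrow> 'a) \<Rightarrow> 'a \<Rightarrow> 'a set set" where
  "Orb \<sigma> z = {associate_class (int_iterate \<sigma> k z) | k. True}"


section \<open>The generalized Weyl algebra\<close>

text \<open>
  The ring presented by generators and relations is realized as ring terms over the generators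
  (elements of the base ring, \<open>x\<close> and \<open>y\<close>) modulo the least congruence that satisfies the ring
  axioms, identifies the ring operations on terms with those of the base ring, and contains the
  four defining families of relations.
\<close>

datatype 'a gwa_term =
    Coef 'a
  | GenX
  | GenY
  | Plus "'a gwa_term" "'a gwa_term"
  | Neg "'a gwa_term"
  | Times "'a gwa_term" "'a gwa_term"

inductive gwa_cong ::
  "('a::comm_ring_1 \<Rightarrow> 'a) \<Rightarrow> 'a \<Rightarrow> 'a gwa_term \<Rightarrow> 'a gwa_term \<Rightarrow> bool"
  for \<sigma> :: "'a \<Rightarrow> 'a" and a :: 'a where
  refl: "gwa_cong \<sigma> a t t"
| sym: "gwa_cong \<sigma> a s t \<Longrightarrow> gwa_cong \<sigma> a t s"
| trans: "gwa_cong \<sigma> a s t \<Longrightarrow> gwa_cong \<sigma> a t u \<Longrightarrow> gwa_cong \<sigma> a s u"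
| plus_cong: "gwa_cong \<sigma> a s s' \<Longrightarrow> gwa_cong \<sigma> a t t' \<Longrightarrow> gwa_cong \<sigma> a (Plus s t) (Plus s' t')"
| neg_cong: "gwa_cong \<sigma> a s s' \<Longrightarrow> gwa_cong \<sigma> a (Neg s) (Neg s')"
| times_cong: "gwa_cong \<sigma> a s s' \<Longrightarrow> gwa_cong \<sigma> a t t' \<Longrightarrow> gwa_cong \<sigma> a (Times s t) (Times s' t')"
| plus_assoc: "gwa_cong \<sigma> a (Plus (Plus s t) u) (Plus s (Plus t u))"
| plus_commute: "gwa_cong \<sigma> a (Plus s t) (Plus t s)"
| plus_zero: "gwa_cong \<sigma> a (Plus (Coef 0) t) t"
| plus_neg: "gwa_cong \<sigma> a (Plus (Neg t) t) (Coef 0)"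
| times_assoc: "gwa_cong \<sigma> a (Times (Times s t) u) (Times s (Times t u))"
| one_times: "gwa_cong \<sigma> a (Times (Coef 1) t) t"
| times_one: "gwa_cong \<sigma> a (Times t (Coef 1)) t"
| distrib_right: "gwa_cong \<sigma> a (Times (Plus s t) u) (Plus (Times s u) (Times t u))"
| distrib_left: "gwa_cong \<sigma> a (Times u (Plus s t)) (Plus (Times u s) (Times u t))"
| coef_plus: "gwa_cong \<sigma> a (Coef (r + s)) (Plus (Coef r) (Coef s))"
| coef_times: "gwa_cong \<sigma> a (Coef (r * s)) (Times (Coef r) (Coef s))"
| x_coef: "gwa_cong \<sigma> a (Times GenX (Coef (\<sigma> r))) (Times (Coef r) GenX)"
| y_coef: "gwa_cong \<sigma> a (Times GenY (Coef r)) (Times (Coef (\<sigma> r)) GenY)"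
| xy: "gwa_cong \<sigma> a (Times GenX GenY) (Coef a)"
| yx: "gwa_cong \<sigma> a (Times GenY GenX) (Coef (\<sigma> a))"

definition gwa_class ::
  "('a::comm_ring_1 \<Rightarrow> 'a) \<Rightarrow> 'a \<Rightarrow> 'a gwa_term \<Rightarrow> 'a gwa_term set" where
  "gwa_class \<sigma> a s = {t. gwa_cong \<sigma> a s t}"

definition GWA :: "('a::comm_ring_1 \<Rightarrow> 'a) \<Rightarrow> 'a \<Rightarrow> 'a gwa_term set ring" where
  "GWA \<sigma> a =
     \<lparr>carrier = range (gwa_class \<sigma> a),
      monoid.mult = (\<lambda>C D. \<Union>s\<in>C. \<Union>t\<in>D. gwa_class \<sigma> a (Times s t)),
      one = gwa_class \<sigma> a (Coef 1),
      zero = gwa_class \<sigma> a (Coef 0),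
      add = (\<lambda>C D. \<Union>s\<in>C. \<Union>t\<in>D. gwa_class \<sigma> a (Plus s t))\<rparr>"

lemma gwa_class_eq_iff: "gwa_class \<sigma> a s = gwa_class \<sigma> a t \<longleftrightarrow> gwa_cong \<sigma> a s t"
proof
  assume "gwa_class \<sigma> a s = gwa_class \<sigma> a t"
  moreover have "t \<in> gwa_class \<sigma> a t" by (simp add: gwa_class_def gwa_cong.refl)
  ultimately have "t \<in> gwa_class \<sigma> a s" by simp
  then show "gwa_cong \<sigma> a s t" by (simp add: gwa_class_def)
next
  assume st: "gwa_cong \<sigma> a s t"
  have "gwa_cong \<sigma> a s u \<longleftrightarrow> gwa_cong \<sigma> a t u" for u
    by (rule iffI) (rule gwa_cong.trans[OF gwa_cong.sym[OF st]] gwa_cong.trans[OF st], assumption)+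
  then show "gwa_class \<sigma> a s = gwa_class \<sigma> a t" by (simp add: gwa_class_def)
qed

lemma GWA_carrier: "carrier (GWA \<sigma> a) = range (gwa_class \<sigma> a)"
  and GWA_one: "\<one>\<^bsub>GWA \<sigma> a\<^esub> = gwa_class \<sigma> a (Coef 1)"
  and GWA_zero: "\<zero>\<^bsub>GWA \<sigma> a\<^esub> = gwa_class \<sigma> a (Coef 0)"
  by (simp_all add: GWA_def)

lemma GWA_mult:
  "gwa_class \<sigma> a s \<otimes>\<^bsub>GWA \<sigma> a\<^esub> gwa_class \<sigma> a t = gwa_class \<sigma> a (Times s t)"
proof -
  have "gwa_class \<sigma> a (Times s' t') = gwa_class \<sigma> a (Times s t)"
    if "s' \<in> gwa_class \<sigma> a s" "t' \<in> gwa_class \<sigma> a t" for s' t'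
    unfolding gwa_class_eq_iff using that[unfolded gwa_class_def mem_Collect_eq]
    by (rule gwa_cong.sym[OF gwa_cong.times_cong])
  then have "(\<Union>s'\<in>gwa_class \<sigma> a s. \<Union>t'\<in>gwa_class \<sigma> a t. gwa_class \<sigma> a (Times s' t')) =
      (\<Union>s'\<in>gwa_class \<sigma> a s. \<Union>t'\<in>gwa_class \<sigma> a t. gwa_class \<sigma> a (Times s t))"
    by (intro SUP_cong HOL.refl)
  moreover have "gwa_class \<sigma> a s \<noteq> {}" "gwa_class \<sigma> a t \<noteq> {}"
    by (auto simp: gwa_class_def intro: gwa_cong.refl)
  ultimately show ?thesis by (simp add: GWA_def)
qed

lemma GWA_add:
  "gwa_class \<sigma> a s \<oplus>\<^bsub>GWA \<sigma> a\<^esub> gwa_class \<sigma> a t = gwa_class \<sigma> a (Plus s t)"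
proof -
  have "gwa_class \<sigma> a (Plus s' t') = gwa_class \<sigma> a (Plus s t)"
    if "s' \<in> gwa_class \<sigma> a s" "t' \<in> gwa_class \<sigma> a t" for s' t'
    unfolding gwa_class_eq_iff using that[unfolded gwa_class_def mem_Collect_eq]
    by (rule gwa_cong.sym[OF gwa_cong.plus_cong])
  then have "(\<Union>s'\<in>gwa_class \<sigma> a s. \<Union>t'\<in>gwa_class \<sigma> a t. gwa_class \<sigma> a (Plus s' t')) =
      (\<Union>s'\<in>gwa_class \<sigma> a s. \<Union>t'\<in>gwa_class \<sigma> a t. gwa_class \<sigma> a (Plus s t))"
    by (intro SUP_cong HOL.refl)
  moreover have "gwa_class \<sigma> a s \<noteq> {}" "gwa_class \<sigma> a t \<noteq> {}"
    by (auto simp: gwa_class_def intro: gwa_cong.refl)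
  ultimately show ?thesis by (simp add: GWA_def)
qed

lemma GWA_ring: "ring (GWA \<sigma> a)"
proof (rule ringI)
  show "abelian_group (GWA \<sigma> a)"
  proof (rule abelian_groupI)
    fix C assume "C \<in> carrier (GWA \<sigma> a)"
    then obtain t where t: "C = gwa_class \<sigma> a t" by (auto simp: GWA_carrier)
    show "\<exists>D\<in>carrier (GWA \<sigma> a). D \<oplus>\<^bsub>GWA \<sigma> a\<^esub> C = \<zero>\<^bsub>GWA \<sigma> a\<^esub>"
      by (rule bexI[of _ "gwa_class \<sigma> a (Neg t)"])
         (auto simp: t GWA_carrier GWA_add GWA_zero gwa_class_eq_iff intro!: rangeI gwa_cong.plus_neg del: equalityI)
  qed (auto simp: GWA_carrier GWA_add GWA_zero gwa_class_eq_iff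
         intro!: rangeI gwa_cong.plus_assoc gwa_cong.plus_commute gwa_cong.plus_zero del: equalityI)
  show "monoid (GWA \<sigma> a)"
    by (rule monoidI)
       (auto simp: GWA_carrier GWA_mult GWA_one gwa_class_eq_iff
         intro!: rangeI gwa_cong.times_assoc gwa_cong.one_times gwa_cong.times_one del: equalityI)
qed (auto simp: GWA_carrier GWA_mult GWA_add gwa_class_eq_iff
       intro!: rangeI gwa_cong.distrib_left gwa_cong.distrib_right del: equalityI)


section \<open>The modules \<open>V\<^sub>p\<close>\<close>

text \<open>\<^const>\<open>module\<close> requires a commutative ring of scalars, \<^const>\<open>submodule\<close> does not.\<close>

locale left_module = R?: ring R + M?: abelian_group M
  for R (structure) and M (structure) +
  assumes smult_closed: "\<lbrakk>b \<in> carrier R; v \<in> carrier M\<rbrakk> \<Longrightarrow> b \<odot>\<^bsub>M\<^esub> v \<in> carrier M"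
    and smult_l_distr: "\<lbrakk>b \<in> carrier R; c \<in> carrier R; v \<in> carrier M\<rbrakk> \<Longrightarrow>
      (b \<oplus>\<^bsub>R\<^esub> c) \<odot>\<^bsub>M\<^esub> v = b \<odot>\<^bsub>M\<^esub> v \<oplus>\<^bsub>M\<^esub> c \<odot>\<^bsub>M\<^esub> v"
    and smult_r_distr: "\<lbrakk>b \<in> carrier R; v \<in> carrier M; w \<in> carrier M\<rbrakk> \<Longrightarrow>
      b \<odot>\<^bsub>M\<^esub> (v \<oplus>\<^bsub>M\<^esub> w) = b \<odot>\<^bsub>M\<^esub> v \<oplus>\<^bsub>M\<^esub> b \<odot>\<^bsub>M\<^esub> w"
    and smult_assoc: "\<lbrakk>b \<in> carrier R; c \<in> carrier R; v \<in> carrier M\<rbrakk> \<Longrightarrow>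
      (b \<otimes>\<^bsub>R\<^esub> c) \<odot>\<^bsub>M\<^esub> v = b \<odot>\<^bsub>M\<^esub> (c \<odot>\<^bsub>M\<^esub> v)"
    and smult_one: "v \<in> carrier M \<Longrightarrow> \<one>\<^bsub>R\<^esub> \<odot>\<^bsub>M\<^esub> v = v"

primrec term_action ::
  "('a::comm_ring_1 \<Rightarrow> 'a) \<Rightarrow> 'a \<Rightarrow> 'a \<Rightarrow> 'a gwa_term \<Rightarrow> 'a \<Rightarrow> 'a" where
  "term_action \<sigma> p q (Coef r') r = r' * r"
| "term_action \<sigma> p q GenX r = inv_into UNIV \<sigma> r * p"
| "term_action \<sigma> p q GenY r = \<sigma> r * q"
| "term_action \<sigma> p q (Plus s t) r = term_action \<sigma> p q s r + term_action \<sigma> p q t r"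
| "term_action \<sigma> p q (Neg t) r = - term_action \<sigma> p q t r"
| "term_action \<sigma> p q (Times s t) r = term_action \<sigma> p q s (term_action \<sigma> p q t r)"

text \<open>
  A class of terms acts through any of its representatives (see \<open>V_smult\<close> below). The fields
  \<open>mult\<close> and \<open>one\<close> of the record are not part of the module structure.
\<close>

definition V_module ::
  "('a::{factorial_semiring, idom} \<Rightarrow> 'a) \<Rightarrow> 'a \<Rightarrow> 'a \<Rightarrow> ('a gwa_term set, 'a) module" where
  "V_module \<sigma> a p =
     \<lparr>carrier = UNIV, monoid.mult = (*), one = 1, zero = 0, add = (+),
      smult = (\<lambda>C r. term_action \<sigma> p (\<sigma> (a div p)) (SOME t. t \<in> C) r)\<rparr>"

context
  fixes \<sigma> :: "'a::{factorial_semiring, idom} \<Rightarrow> 'a" and a p :: 'a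
  assumes aut: "ring_automorphism \<sigma>" and dvd: "p dvd a"
begin

lemma aut_simps:
  "\<sigma> (inv_into UNIV \<sigma> r) = r" "inv_into UNIV \<sigma> (\<sigma> r) = r"
  "\<sigma> (r + s) = \<sigma> r + \<sigma> s" "\<sigma> (r * s) = \<sigma> r * \<sigma> s"
  using aut by (auto simp: ring_automorphism_def surj_f_inv_f bij_is_surj bij_is_inj)

lemma aut_inv_simps:
  "inv_into UNIV \<sigma> (r + s) = inv_into UNIV \<sigma> r + inv_into UNIV \<sigma> s"
  "inv_into UNIV \<sigma> (r * s) = inv_into UNIV \<sigma> r * inv_into UNIV \<sigma> s"
  by (metis aut_simps)+

lemma term_action_add:
  "term_action \<sigma> p q t (r + s) = term_action \<sigma> p q t r + term_action \<sigma> p q t s"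
  by (induction t arbitrary: r s) (simp_all add: aut_simps aut_inv_simps algebra_simps)

lemma term_action_cong:
  assumes "gwa_cong \<sigma> a s t"
  shows "term_action \<sigma> p (\<sigma> (a div p)) s r = term_action \<sigma> p (\<sigma> (a div p)) t r"
  using assms
proof (induction arbitrary: r)
  case xy
  have "r * (a div p) * p = a * r" using dvd by (simp add: mult.assoc mult.commute[of r])
  then show ?case by (simp add: aut_simps aut_inv_simps)
next
  case yx
  have "\<sigma> p * \<sigma> (a div p) = \<sigma> a"
    unfolding aut_simps(4)[symmetric] by (simp add: dvd)
  then have "r * \<sigma> p * \<sigma> (a div p) = \<sigma> a * r" by (simp add: mult.assoc mult.commute[of r])
  then show ?case by (simp add: aut_simps)
qed (simp_all add: aut_simps aut_inv_simps term_action_add algebra_simps)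

lemma V_smult:
  "gwa_class \<sigma> a t \<odot>\<^bsub>V_module \<sigma> a p\<^esub> r = term_action \<sigma> p (\<sigma> (a div p)) t r"
proof -
  have "gwa_cong \<sigma> a t (SOME u. u \<in> gwa_class \<sigma> a t)"
    unfolding gwa_class_def mem_Collect_eq by (rule someI[of _ t]) (rule gwa_cong.refl)
  then show ?thesis by (simp add: V_module_def term_action_cong)
qed

lemma V_left_module: "left_module (GWA \<sigma> a) (V_module \<sigma> a p)"
proof -
  have "abelian_group (V_module \<sigma> a p)"
  proof (rule abelian_groupI)
    fix r assume "r \<in> carrier (V_module \<sigma> a p)"
    show "\<exists>s\<in>carrier (V_module \<sigma> a p). s \<oplus>\<^bsub>V_module \<sigma> a p\<^esub> r = \<zero>\<^bsub>V_module \<sigma> a p\<^esub>"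
      by (rule bexI[of _ "- r"]) (auto simp: V_module_def)
  qed (auto simp: V_module_def algebra_simps)
  moreover have "carrier (V_module \<sigma> a p) = UNIV" "add (V_module \<sigma> a p) = (+)"
    by (auto simp: V_module_def)
  ultimately show ?thesis
    by (intro left_module.intro GWA_ring left_module_axioms.intro)
       (auto simp: GWA_carrier GWA_add GWA_mult GWA_one V_smult term_action_add)
qed

end

text \<open>\<open>\<langle>g\<rangle> = Rg\<close>; by \<open>V_smult\<close>, coefficients act on \<open>V\<^sub>p\<close> by multiplication.\<close>

definition R_span :: "'a::comm_ring_1 \<Rightarrow> 'a set" where
  "R_span g = {r * g | r. True}"


section \<open>Chain products\<close>

text \<open>\<open>chain_length \<sigma> r s\<close> is only meaningful if \<open>s\<close> is associated to some \<open>\<sigma>\<^sup>n r\<close> with \<open>n \<ge> 0\<close>.\<close>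

definition chain_length :: "('a::comm_monoid_mult \<Rightarrow> 'a) \<Rightarrow> 'a \<Rightarrow> 'a \<Rightarrow> nat" where
  "chain_length \<sigma> r s = (LEAST n. associates s ((\<sigma> ^^ n) r))"

definition chain_product :: "('a::comm_monoid_mult \<Rightarrow> 'a) \<Rightarrow> 'a \<Rightarrow> 'a \<Rightarrow> 'a" where
  "chain_product \<sigma> r s = (\<Prod>i=0..chain_length \<sigma> r s. (\<sigma> ^^ i) r)"

definition basic_chain :: "('a::comm_semiring_1 \<Rightarrow> 'a) \<Rightarrow> 'a \<Rightarrow> 'a \<Rightarrow> 'a \<Rightarrow> 'a \<Rightarrow> bool" where
  "basic_chain \<sigma> p q q0 p0 \<longleftrightarrow>
     irreducible q0 \<and> q0 dvd q \<and> irreducible p0 \<and> p0 dvd p \<and>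
     (\<exists>n. associates p0 ((\<sigma> ^^ n) q0)) \<and>
     (finite (Orb \<sigma> q0) \<longrightarrow> chain_length \<sigma> q0 p0 + 1 < card (Orb \<sigma> q0))"

definition full_orbit_product :: "('a::comm_monoid_mult \<Rightarrow> 'a) \<Rightarrow> 'a \<Rightarrow> 'a" where
  "full_orbit_product \<sigma> z = (\<Prod>k=1..card (Orb \<sigma> z). (\<sigma> ^^ k) z)"

definition chain_orbit_factorization ::
  "('a::comm_semiring_1 \<Rightarrow> 'a) \<Rightarrow> 'a \<Rightarrow> 'a \<Rightarrow> 'a \<Rightarrow>
   nat \<Rightarrow> (nat \<Rightarrow> 'a) \<Rightarrow> (nat \<Rightarrow> 'a) \<Rightarrow> nat \<Rightarrow> (nat \<Rightarrow> 'a) \<Rightarrow> bool" where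
  "chain_orbit_factorization \<sigma> p q g n qs ps m zs \<longleftrightarrow>
     (\<forall>i\<in>{1..n}. basic_chain \<sigma> p q (qs i) (ps i)) \<and>
     (\<Prod>i=1..n. qs i) dvd q \<and> (\<Prod>i=1..n. ps i) dvd p \<and>
     (\<forall>j\<in>{1..m}. irreducible (zs j) \<and> finite (Orb \<sigma> (zs j))) \<and>
     associates g ((\<Prod>i=1..n. chain_product \<sigma> (qs i) (ps i)) *
                   (\<Prod>j=1..m. full_orbit_product \<sigma> (zs j)))"

end

(* Rg is a submodule iff g | \<sigma>(g) q and \<sigma>(g) | g \<sigma>(p); this condition is multiplicative in (p, q, g), and
   chain products and full orbits satisfy it. Conversely, induct on the number of prime factors of g.
   If g is divisible by a whole orbit, split that orbit off. Otherwise take an interval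
   [r], ..., [\<sigma>^n r] of an orbit that consists of divisors of g and is maximal: r does not divide
   \<sigma>(g), so it divides q, and likewise \<sigma>^n r divides p, so the interval is a basic chain, and splitting
   it off leaves the condition true for p / \<sigma>^n r, q / r and g divided by the chain. The remaining
   chains divide g, so by maximality each is coprime to this one or contained in it. *)

theory Submission
  imports Defs
begin

section \<open>Associates and automorphisms\<close>

lemma associates_refl [simp]: "associates r r"
  by (simp add: associates_def)

lemma associates_sym: "associates r s \<Longrightarrow> associates s r"
  by (simp add: associates_def)

lemma associates_trans: "associates r s \<Longrightarrow> associates s t \<Longrightarrow> associates r t"
  by (auto simp: associates_def intro: dvd_trans)

lemma associates_dvd_iff_left: "associates r s \<Longrightarrow> r dvd t \<longleftrightarrow> s dvd t"
  by (auto simp: associates_def intro: dvd_trans)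

lemma associates_dvd_iff_right: "associates r s \<Longrightarrow> t dvd r \<longleftrightarrow> t dvd s"
  by (auto simp: associates_def intro: dvd_trans)

lemma associates_mult: "associates r s \<Longrightarrow> associates t u \<Longrightarrow> associates (r * t) (s * u)"
  by (simp add: associates_def mult_dvd_mono)

lemma associate_class_eq_iff: "associate_class r = associate_class s \<longleftrightarrow> associates r s"
proof
  assume "associate_class r = associate_class s"
  moreover have "s \<in> associate_class s" by (simp add: associate_class_def)
  ultimately show "associates r s" by (auto simp: associate_class_def)
next
  assume "associates r s"
  then show "associate_class r = associate_class s"
    unfolding associate_class_def by (auto intro: associates_trans associates_sym)
qed

section \<open>Divisibility by irreducibles in a factorial ring\<close>

lemma irreducible_dvd_associates:
  fixes r s :: "'a::factorial_semiring"
  assumes "irreducible r" "irreducible s" "r dvd s"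
  shows "associates r s"
proof -
  obtain t where t: "s = r * t" using assms(3) by (rule dvdE)
  have "is_unit t" using irreducibleD[OF assms(2) t] assms(1) by (auto simp: irreducible_def)
  then show ?thesis by (simp add: associates_def t mult_unit_dvd_iff)
qed

text \<open>Every irreducible divisor is associated to its normalization, which is one of the
  finitely many prime factors. This finiteness is what forces orbits inside the support of
  \<open>g\<close> to be periodic.\<close>

lemma finite_irreducible_divisor_classes:
  fixes g :: "'a::factorial_semiring"
  assumes "g \<noteq> 0"
  shows "finite (associate_class ` {r. irreducible r \<and> r dvd g})"
proof (rule finite_subset)
  show "associate_class ` {r. irreducible r \<and> r dvd g} \<subseteq> associate_class ` prime_factors g"
  proof
    fix C assume "C \<in> associate_class ` {r. irreducible r \<and> r dvd g}"
    then obtain r where r: "C = associate_class r" "irreducible r" "r dvd g" by auto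
    then have "normalize r \<in> prime_factors g"
      using assms by (auto simp: in_prime_factors_iff irreducible_imp_prime_elem)
    moreover have "associate_class r = associate_class (normalize r)"
      by (simp add: associate_class_eq_iff associates_def)
    ultimately show "C \<in> associate_class ` prime_factors g" using r(1) by auto
  qed
qed simp

lemma irreducible_dvd_prodD:
  fixes s :: "'a::factorial_semiring"
  assumes "irreducible s" "finite A" "s dvd prod f A"
  shows "\<exists>i\<in>A. s dvd f i"
  using assms(2,3)
proof (induction A rule: finite_induct)
  case empty
  then show ?case using assms(1) by (simp add: irreducible_def)
next
  case (insert x A)
  then show ?case
    using prime_elem_dvd_multD[OF irreducible_imp_prime_elem[OF assms(1)], of "f x" "prod f A"] by auto
qed

text \<open>Add the factors one at a time: a new irreducible is prime and associated to none of the
  earlier ones, so it does not divide their product and must divide the cofactor in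
  \<open>g\<close>.\<close>

lemma prod_distinct_irreducibles_dvd:
  fixes f :: "'b \<Rightarrow> 'a::factorial_semiring"
  assumes "finite A" "\<And>i. i \<in> A \<Longrightarrow> irreducible (f i)" "\<And>i. i \<in> A \<Longrightarrow> f i dvd g"
    and "\<And>i j. i \<in> A \<Longrightarrow> j \<in> A \<Longrightarrow> i \<noteq> j \<Longrightarrow> \<not> associates (f i) (f j)"
  shows "prod f A dvd g"
  using assms
proof (induction A rule: finite_induct)
  case (insert x A)
  have "prod f A dvd g" by (rule insert.IH) (use insert.prems in auto)
  then obtain h where h: "g = prod f A * h" by (rule dvdE)
  have px: "prime_elem (f x)" using insert.prems(1) by (simp add: irreducible_imp_prime_elem)
  have "\<not> f x dvd prod f A"
  proof
    assume "f x dvd prod f A"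
    then obtain i where "i \<in> A" "f x dvd f i"
      using irreducible_dvd_prodD[of "f x" A f] insert.prems(1) insert.hyps(1) by blast
    then show False
      using irreducible_dvd_associates[of "f x" "f i"] insert.prems(1,3)[of x] insert.prems(1)[of i] insert.hyps(2)
      by auto
  qed
  then have "f x dvd h"
    using prime_elem_dvd_multD[OF px] insert.prems(2)[of x] h by auto
  then show ?case using insert.hyps by (simp add: h mult.commute mult_dvd_mono)
qed simp

text \<open>In \<open>s * h = g * t\<close> the prime \<open>s\<close> has to divide
  \<open>t\<close>, so it cancels. This removes the extra prime left over when a chain is split
  off.\<close>

lemma dvd_cancel_irreducible:
  fixes s :: "'a::factorial_semiring"
  assumes "irreducible s" "\<not> s dvd g" "g dvd s * h"
  shows "g dvd h"
proof -
  obtain t where t: "s * h = g * t" using assms(3) by (rule dvdE)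
  have "s dvd t"
    using prime_elem_dvd_multD[OF irreducible_imp_prime_elem[OF assms(1)], of g t] assms(2)
    by (metis t dvd_triv_left)
  then obtain u where "t = s * u" by (rule dvdE)
  then have "s * h = s * (g * u)" using t by (simp add: ac_simps)
  then show ?thesis using assms(1) by (auto simp: irreducible_def)
qed

section \<open>Automorphisms preserve and reflect divisibility\<close>

lemma ring_automorphism_funpow: "ring_automorphism \<sigma> \<Longrightarrow> ring_automorphism (\<sigma> ^^ n)"
  by (induction n) (auto simp: ring_automorphism_def intro: bij_comp)

lemma ring_automorphism_inv: "ring_automorphism \<sigma> \<Longrightarrow> ring_automorphism (inv_into UNIV \<sigma>)"
  by (auto simp: ring_automorphism_def bij_imp_bij_inv bij_is_inj bij_is_surj surj_f_inv_f
    intro!: inv_f_eq)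

lemma ring_automorphism_int_iterate: "ring_automorphism \<sigma> \<Longrightarrow> ring_automorphism (int_iterate \<sigma> k)"
  by (simp add: int_iterate_def ring_automorphism_funpow ring_automorphism_inv)

lemma ring_automorphism_mult: "ring_automorphism \<sigma> \<Longrightarrow> \<sigma> (r * s) = \<sigma> r * \<sigma> s"
  by (simp add: ring_automorphism_def)

lemma ring_automorphism_one: "ring_automorphism \<sigma> \<Longrightarrow> \<sigma> 1 = 1"
  by (simp add: ring_automorphism_def)

lemma ring_automorphism_zero: "ring_automorphism \<sigma> \<Longrightarrow> \<sigma> 0 = 0"
  by (metis add_cancel_right_left ring_automorphism_def)

lemma ring_automorphism_inv_cancel:
  assumes "ring_automorphism \<sigma>"
  shows "\<sigma> (inv_into UNIV \<sigma> r) = r" "inv_into UNIV \<sigma> (\<sigma> r) = r"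
  using assms by (auto simp: ring_automorphism_def surj_f_inv_f bij_is_surj bij_is_inj)

lemma ring_automorphism_dvd_iff:
  assumes "ring_automorphism \<sigma>"
  shows "(\<sigma> :: 'a::comm_ring_1 \<Rightarrow> 'a) r dvd \<sigma> s \<longleftrightarrow> r dvd s"
proof -
  have "\<tau> r dvd \<tau> s" if "ring_automorphism \<tau>" "r dvd s" for \<tau> :: "'a \<Rightarrow> 'a" and r s
    using that by (auto simp: ring_automorphism_mult elim!: dvdE)
  from this[OF assms] this[OF ring_automorphism_inv[OF assms], of "\<sigma> r" "\<sigma> s"]
  show ?thesis by (auto simp: ring_automorphism_inv_cancel[OF assms])
qed

lemma ring_automorphism_associates_iff:
  "ring_automorphism \<sigma> \<Longrightarrow> associates (\<sigma> r) (\<sigma> s) \<longleftrightarrow> associates r s"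
  by (simp add: associates_def ring_automorphism_dvd_iff)

lemma ring_automorphism_irreducible:
  fixes \<sigma> :: "'a::{factorial_semiring, idom} \<Rightarrow> 'a"
  assumes "ring_automorphism \<sigma>" "irreducible r"
  shows "irreducible (\<sigma> r)"
proof (rule irreducibleI)
  have unit: "\<sigma> s dvd 1 \<longleftrightarrow> s dvd 1" for s
    using ring_automorphism_dvd_iff[OF assms(1), of s 1] ring_automorphism_one[OF assms(1)] by simp
  show "\<sigma> r \<noteq> 0"
    using assms by (metis ring_automorphism_inv_cancel(2) ring_automorphism_zero irreducible_def)
  show "\<not> \<sigma> r dvd 1" using assms(2) by (simp add: unit irreducible_def)
  fix s t assume "\<sigma> r = s * t"
  \<comment> \<open>By surjectivity a factorization of \<open>\<sigma> r\<close> pulls back to one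
    of \<open>r\<close>.\<close>
  moreover obtain s' t' where st: "s = \<sigma> s'" "t = \<sigma> t'"
    by (metis ring_automorphism_inv_cancel(1)[OF assms(1)])
  ultimately have "r = s' * t'"
    by (metis assms(1) ring_automorphism_inv_cancel(2) ring_automorphism_mult)
  then show "s dvd 1 \<or> t dvd 1" using assms(2) by (auto simp: unit st dest: irreducibleD)
qed

lemmas irreducible_funpow = ring_automorphism_irreducible[OF ring_automorphism_funpow]
lemmas irreducible_int_iterate = ring_automorphism_irreducible[OF ring_automorphism_int_iterate]


section \<open>Orbits\<close>

lemma int_iterate_0 [simp]: "int_iterate \<sigma> 0 z = z"
  by (simp add: int_iterate_def)

lemma int_iterate_of_nat: "int_iterate \<sigma> (int n) = \<sigma> ^^ n"
  by (simp add: int_iterate_def)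

lemma int_iterate_step:
  assumes "ring_automorphism \<sigma>"
  shows "\<sigma> (int_iterate \<sigma> k z) = int_iterate \<sigma> (k + 1) z"
proof (cases "0 \<le> k")
  case True
  then show ?thesis by (simp add: int_iterate_def nat_add_distrib)
next
  case False
  then have "nat (- k) = Suc (nat (- (k + 1)))" by simp
  with False show ?thesis
    by (auto simp: int_iterate_def ring_automorphism_inv_cancel[OF assms])
qed

lemma funpow_int_iterate:
  "ring_automorphism \<sigma> \<Longrightarrow> (\<sigma> ^^ n) (int_iterate \<sigma> k z) = int_iterate \<sigma> (k + int n) z"
  by (induction n) (simp_all add: int_iterate_step ac_simps)

text \<open>Since \<open>\<sigma>\<close> preserves and reflects association, only the difference of
  two exponents matters.\<close>

lemma associates_int_iterate_shift:
  assumes "ring_automorphism \<sigma>"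
  shows "associates (int_iterate \<sigma> (i + t) z) (int_iterate \<sigma> (j + t) z) \<longleftrightarrow>
    associates (int_iterate \<sigma> i z) (int_iterate \<sigma> j z)"
proof -
  have step: "associates (int_iterate \<sigma> (i + 1) z) (int_iterate \<sigma> (j + 1) z) \<longleftrightarrow>
    associates (int_iterate \<sigma> i z) (int_iterate \<sigma> j z)" for i j
    using ring_automorphism_associates_iff[OF assms] by (metis int_iterate_step[OF assms])
  show ?thesis
  proof (induction t rule: int_induct[where k = 0])
    case (step1 t)
    then show ?case using step[of "i + t" "j + t"] by (simp add: ac_simps)
  next
    case (step2 t)
    then show ?case using step[of "i + (t - 1)" "j + (t - 1)"] by simp
  qed simp
qed

lemma associates_int_iterate_period:
  assumes "ring_automorphism \<sigma>" "associates z (int_iterate \<sigma> e z)"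
  shows "associates (int_iterate \<sigma> k z) (int_iterate \<sigma> (k + e * t) z)"
proof -
  have shift: "associates (int_iterate \<sigma> k z) (int_iterate \<sigma> (k + e) z)" for k
    using associates_int_iterate_shift[OF assms(1), of 0 k z e] assms(2) by (simp add: ac_simps)
  show ?thesis
  proof (induction t rule: int_induct[where k = 0])
    case (step1 t)
    then show ?case using associates_trans[OF step1(2) shift[of "k + e * t"]] by (simp add: algebra_simps)
  next
    case (step2 t)
    have "associates (int_iterate \<sigma> (k + e * t) z) (int_iterate \<sigma> (k + e * (t - 1)) z)"
      using shift[of "k + e * (t - 1)"] by (auto simp: algebra_simps intro: associates_sym)
    then show ?case using associates_trans[OF step2(2)] by blast
  qed simp
qed

text \<open>Pigeonhole: two of the infinitely many exponents give the same class, and their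
  difference is a period.\<close>

lemma period_of_infinite:
  assumes "ring_automorphism \<sigma>" "infinite I" "finite ((\<lambda>k. associate_class (int_iterate \<sigma> k z)) ` I)"
  obtains e where "0 < e" "associates z (int_iterate \<sigma> e z)"
proof -
  have "\<not> inj_on (\<lambda>k. associate_class (int_iterate \<sigma> k z)) I"
    using assms(2,3) finite_imageD by blast
  then obtain i j where ij: "i \<noteq> j" "associates (int_iterate \<sigma> i z) (int_iterate \<sigma> j z)"
    by (auto simp: inj_on_def associate_class_eq_iff)
  have "\<exists>i j. i < j \<and> associates (int_iterate \<sigma> i z) (int_iterate \<sigma> j z)"
    using ij by (metis associates_sym linorder_neqE)
  then obtain i j where "i < j" "associates (int_iterate \<sigma> i z) (int_iterate \<sigma> j z)" by blast
  then show ?thesis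
    using that[of "j - i"] associates_int_iterate_shift[OF assms(1), of 0 i z "j - i"] by simp
qed

lemma Orb_eq_image: "Orb \<sigma> z = range (\<lambda>k. associate_class (int_iterate \<sigma> k z))"
  by (auto simp: Orb_def)

text \<open>A finite orbit has a least positive period \<open>D\<close>; the exponents from 1 to
  \<open>D\<close> represent each class exactly once, so \<open>D\<close> is the size of the
  orbit.\<close>

lemma card_Orb_period:
  assumes aut: "ring_automorphism \<sigma>" and fin: "finite (Orb \<sigma> z)"
  shows "associates z ((\<sigma> ^^ card (Orb \<sigma> z)) z)" "0 < card (Orb \<sigma> z)"
    and "\<And>i j. i \<in> {1..card (Orb \<sigma> z)} \<Longrightarrow> j \<in> {1..card (Orb \<sigma> z)} \<Longrightarrow> i \<noteq> j \<Longrightarrow>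
      \<not> associates ((\<sigma> ^^ i) z) ((\<sigma> ^^ j) z)"
proof -
  let ?P = "\<lambda>d. 0 < d \<and> associates z ((\<sigma> ^^ d) z)"
  obtain e where "0 < e" "associates z (int_iterate \<sigma> e z)"
    using period_of_infinite[OF aut, of UNIV z] fin by (auto simp: Orb_eq_image infinite_UNIV_int)
  then have ex: "?P (nat e)" by (simp add: int_iterate_def)
  define D where "D = (LEAST d. ?P d)"
  have D: "0 < D" "associates z ((\<sigma> ^^ D) z)"
    using LeastI[of ?P, OF ex] by (auto simp: D_def)
  have distinct_lt: "\<not> associates ((\<sigma> ^^ i) z) ((\<sigma> ^^ j) z)" if "1 \<le> i" "i < j" "j \<le> D" for i j
  proof
    assume "associates ((\<sigma> ^^ i) z) ((\<sigma> ^^ j) z)"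
    then have "associates (int_iterate \<sigma> (0 + int i) z) (int_iterate \<sigma> (int (j - i) + int i) z)"
      using that by (simp add: int_iterate_of_nat flip: of_nat_add)
    then have "?P (j - i)"
      using that unfolding associates_int_iterate_shift[OF aut] by (simp add: int_iterate_of_nat del: of_nat_diff)
    moreover have "j - i < D" using that by linarith
    ultimately show False using not_less_Least[of "j - i" ?P] by (simp add: D_def)
  qed
  then have distinct: "\<not> associates ((\<sigma> ^^ i) z) ((\<sigma> ^^ j) z)"
    if "i \<in> {1..D}" "j \<in> {1..D}" "i \<noteq> j" for i j
    using that by (metis associates_sym atLeastAtMost_iff linorder_neqE_nat)
  have "Orb \<sigma> z = (\<lambda>i. associate_class ((\<sigma> ^^ i) z)) ` {1..D}"
  proof (intro equalityI subsetI)
    fix C assume "C \<in> Orb \<sigma> z"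
    then obtain k where C: "C = associate_class (int_iterate \<sigma> k z)" by (auto simp: Orb_def)
    \<comment> \<open>Reduce the exponent modulo \<open>D\<close>, using the representatives 1 to
      \<open>D\<close> over which \<open>full_orbit_product\<close> runs: the residue 0 is replaced
      by \<open>D\<close>. The number \<open>t\<close> counts the periods added to \<open>k\<close>
      to reach \<open>i\<close>.\<close>
    define u where "u = k mod int D"
    define i where "i = (if u = 0 then D else nat u)"
    define t where "t = (if u = 0 then 1 - k div int D else - (k div int D))"
    have u: "u < int D" "0 \<le> u" using D(1) by (simp_all add: u_def)
    then have i: "i \<in> {1..D}" using D(1) by (auto simp: i_def)
    have "k = int D * (k div int D) + u" by (simp add: u_def)
    then have "int i = k + int D * t"
      using u D(1) by (auto simp: i_def t_def algebra_simps)
    then have "C = associate_class ((\<sigma> ^^ i) z)"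
      using associates_int_iterate_period[OF aut, of z "int D" k t] D(2)
      by (simp add: C associate_class_eq_iff flip: int_iterate_of_nat)
    then show "C \<in> (\<lambda>i. associate_class ((\<sigma> ^^ i) z)) ` {1..D}" using i by blast
  next
    fix C assume "C \<in> (\<lambda>i. associate_class ((\<sigma> ^^ i) z)) ` {1..D}"
    then show "C \<in> Orb \<sigma> z" by (auto simp: Orb_def simp flip: int_iterate_of_nat)
  qed
  moreover have "inj_on (\<lambda>i. associate_class ((\<sigma> ^^ i) z)) {1..D}"
    using distinct by (intro inj_onI) (auto simp: associate_class_eq_iff)
  ultimately have "card (Orb \<sigma> z) = D" by (simp add: card_image)
  with D distinct show "associates z ((\<sigma> ^^ card (Orb \<sigma> z)) z)" "0 < card (Orb \<sigma> z)"
    "\<And>i j. i \<in> {1..card (Orb \<sigma> z)} \<Longrightarrow> j \<in> {1..card (Orb \<sigma> z)} \<Longrightarrow> i \<noteq> j \<Longrightarrow>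
      \<not> associates ((\<sigma> ^^ i) z) ((\<sigma> ^^ j) z)" by auto
qed

section \<open>The factors of a chain product\<close>

lemma chain_length_distinct:
  assumes aut: "ring_automorphism \<sigma>" and ex: "\<exists>n. associates s ((\<sigma> ^^ n) r)"
    and "i \<le> chain_length \<sigma> r s" "j \<le> chain_length \<sigma> r s" "i \<noteq> j"
  shows "\<not> associates ((\<sigma> ^^ i) r) ((\<sigma> ^^ j) r)"
proof -
  let ?m = "chain_length \<sigma> r s"
  have m: "associates s ((\<sigma> ^^ ?m) r)" unfolding chain_length_def by (rule LeastI_ex[OF ex])
  have "\<not> associates ((\<sigma> ^^ i) r) ((\<sigma> ^^ j) r)" if "i < j" "j \<le> ?m" for i j
  proof
    assume "associates ((\<sigma> ^^ i) r) ((\<sigma> ^^ j) r)"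
    \<comment> \<open>Move the repetition to the end of the chain: \<open>s\<close> would already be
      reached at step \<open>?m - j + i\<close>, against the minimality of
      \<open>?m\<close>.\<close>
    then have "associates ((\<sigma> ^^ (?m - j)) ((\<sigma> ^^ i) r)) ((\<sigma> ^^ (?m - j)) ((\<sigma> ^^ j) r))"
      by (simp add: ring_automorphism_associates_iff[OF ring_automorphism_funpow[OF aut]])
    then have "associates ((\<sigma> ^^ (?m - j + i)) r) ((\<sigma> ^^ (?m - j + j)) r)"
      unfolding funpow_add comp_def .
    then have "associates s ((\<sigma> ^^ (?m - j + i)) r)"
      using m that by (auto intro: associates_trans associates_sym)
    moreover have "?m - j + i < ?m" using that by linarith
    ultimately show False
      using not_less_Least[of "?m - j + i" "\<lambda>n. associates s ((\<sigma> ^^ n) r)"]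
      by (simp add: chain_length_def)
  qed
  then show ?thesis using assms(3-5) by (metis associates_sym linorder_neqE_nat)
qed

lemma chain_length_associates:
  "\<exists>n. associates s ((\<sigma> ^^ n) r) \<Longrightarrow> associates s ((\<sigma> ^^ chain_length \<sigma> r s) r)"
  unfolding chain_length_def by (rule LeastI_ex)

lemma funpow_dvd_chain_product:
  fixes \<sigma> :: "'a::comm_semiring_1 \<Rightarrow> 'a"
  shows "i \<le> chain_length \<sigma> r s \<Longrightarrow> (\<sigma> ^^ i) r dvd chain_product \<sigma> r s"
  unfolding chain_product_def by (rule dvd_prod_eqI[of _ i]) auto

text \<open>By minimality of the chain length the factors are pairwise non-associated irreducibles,
  so dividing \<open>g\<close> one by one is enough.\<close>

lemma chain_product_dvd:
  fixes \<sigma> :: "'a::{factorial_semiring, idom} \<Rightarrow> 'a"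
  assumes aut: "ring_automorphism \<sigma>" and "irreducible r" "\<exists>n. associates s ((\<sigma> ^^ n) r)"
    and "\<And>i. i \<le> chain_length \<sigma> r s \<Longrightarrow> (\<sigma> ^^ i) r dvd g"
  shows "chain_product \<sigma> r s dvd g"
  unfolding chain_product_def
  by (rule prod_distinct_irreducibles_dvd)
     (use assms chain_length_distinct[OF aut, of s r] irreducible_funpow[OF aut] in auto)


section \<open>Stable elements\<close>

text \<open>The two conditions say that \<open>Rg\<close> is closed under \<open>y\<close> and, after applying \<open>\<sigma>\<close>, under \<open>x\<close>.\<close>

definition stable :: "('a::comm_ring_1 \<Rightarrow> 'a) \<Rightarrow> 'a \<Rightarrow> 'a \<Rightarrow> 'a \<Rightarrow> bool" where
  "stable \<sigma> p q g \<longleftrightarrow> g dvd \<sigma> g * q \<and> \<sigma> g dvd g * \<sigma> p"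

lemma mem_R_span_iff: "r \<in> R_span g \<longleftrightarrow> g dvd r"
  by (auto simp: R_span_def dvd_def mult.commute)

text \<open>An ideal is closed under all terms once it is closed under the two generators
  \<open>x\<close> and \<open>y\<close>, and for a principal ideal it suffices to test the generator
  \<open>g\<close>.\<close>

lemma submodule_R_span_iff:
  fixes \<sigma> :: "'a::{factorial_semiring, idom} \<Rightarrow> 'a"
  assumes aut: "ring_automorphism \<sigma>" and p: "p dvd a"
  shows "submodule (R_span g) (GWA \<sigma> a) (V_module \<sigma> a p) \<longleftrightarrow> stable \<sigma> p (\<sigma> (a div p)) g"
proof
  assume sub: "submodule (R_span g) (GWA \<sigma> a) (V_module \<sigma> a p)"
  have act: "g dvd term_action \<sigma> p (\<sigma> (a div p)) t g" for t
    using submodule.smult_closed[OF sub, of "gwa_class \<sigma> a t" g]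
    by (simp add: GWA_carrier V_smult[OF aut p] mem_R_span_iff)
  \<comment> \<open>Applying \<open>\<sigma>\<close> to the condition for \<open>x\<close>
    eliminates the inverse automorphism.\<close>
  have "\<sigma> g dvd \<sigma> (inv_into UNIV \<sigma> g * p)"
    using act[of GenX] by (simp add: ring_automorphism_dvd_iff[OF aut])
  then show "stable \<sigma> p (\<sigma> (a div p)) g"
    using act[of GenY]
    by (simp add: stable_def ring_automorphism_mult[OF aut] ring_automorphism_inv_cancel[OF aut])
next
  assume st: "stable \<sigma> p (\<sigma> (a div p)) g"
  have x: "g dvd inv_into UNIV \<sigma> r * p" if "g dvd r" for r
  proof -
    have "\<sigma> g dvd r * \<sigma> p"
      using st that by (meson stable_def dvd_trans mult_dvd_mono dvd_refl)
    then have "\<sigma> g dvd \<sigma> (inv_into UNIV \<sigma> r * p)"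
      by (simp add: ring_automorphism_mult[OF aut] ring_automorphism_inv_cancel[OF aut])
    then show ?thesis by (simp add: ring_automorphism_dvd_iff[OF aut])
  qed
  have y: "g dvd \<sigma> r * \<sigma> (a div p)" if "g dvd r" for r
    using st that by (meson stable_def dvd_trans mult_dvd_mono dvd_refl ring_automorphism_dvd_iff[OF aut])
  have act: "g dvd r \<Longrightarrow> g dvd term_action \<sigma> p (\<sigma> (a div p)) t r" for t r
    by (induction t arbitrary: r) (simp_all add: x y)
  have grp: "group (add_monoid (V_module \<sigma> a p))"
    using V_left_module[OF aut p] by (simp add: left_module_def abelian_group.a_group)
  show "submodule (R_span g) (GWA \<sigma> a) (V_module \<sigma> a p)"
  proof (intro submodule.intro subgroup.intro submodule_axioms.intro)
    fix r assume "r \<in> R_span g"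
    moreover have "inv\<^bsub>add_monoid (V_module \<sigma> a p)\<^esub> r = - r"
      by (rule group.inv_equality[OF grp]) (simp_all add: V_module_def)
    ultimately show "inv\<^bsub>add_monoid (V_module \<sigma> a p)\<^esub> r \<in> R_span g"
      by (simp add: mem_R_span_iff)
  next
    fix C r assume "C \<in> carrier (GWA \<sigma> a)" "r \<in> R_span g"
    then show "C \<odot>\<^bsub>V_module \<sigma> a p\<^esub> r \<in> R_span g"
      by (auto simp: GWA_carrier V_smult[OF aut p] mem_R_span_iff act)
  qed (auto simp: V_module_def mem_R_span_iff)
qed

section \<open>Stability of products, chains and full orbits\<close>

lemma stable_mult:
  assumes "ring_automorphism \<sigma>" "stable \<sigma> p q g" "stable \<sigma> p' q' g'"
  shows "stable \<sigma> (p * p') (q * q') (g * g')"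
  using mult_dvd_mono[of g "\<sigma> g * q" g' "\<sigma> g' * q'"] mult_dvd_mono[of "\<sigma> g" "g * \<sigma> p" "\<sigma> g'" "g' * \<sigma> p'"]
    assms(2,3)
  by (simp add: stable_def ring_automorphism_mult[OF assms(1)] ac_simps)

lemma stable_one: "ring_automorphism \<sigma> \<Longrightarrow> stable \<sigma> 1 1 1"
  by (simp add: stable_def ring_automorphism_one)

text \<open>Each factor uses its own share of \<open>p\<close> and \<open>q\<close>; hence the
  requirement that the products of the end points divide \<open>p\<close> and
  \<open>q\<close>.\<close>

lemma stable_prod:
  assumes "ring_automorphism \<sigma>" "\<And>i. i \<in> A \<Longrightarrow> stable \<sigma> (p i) (q i) (g i)"
  shows "stable \<sigma> (prod p A) (prod q A) (prod g A)"
  using assms(2)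
  by (induction A rule: infinite_finite_induct)
     (simp_all add: stable_one stable_mult assms(1))

lemma stable_mono:
  assumes "ring_automorphism \<sigma>" "stable \<sigma> p q g" "p dvd p'" "q dvd q'"
  shows "stable \<sigma> p' q' g"
  using assms by (meson stable_def dvd_trans mult_dvd_mono dvd_refl ring_automorphism_dvd_iff)

lemma stable_associates:
  assumes aut: "ring_automorphism \<sigma>" and "associates g h" "stable \<sigma> p q g"
  shows "stable \<sigma> p q h"
proof -
  have "associates (\<sigma> g) (\<sigma> h)" using assms(2) by (simp add: ring_automorphism_associates_iff[OF aut])
  then show ?thesis
    using assms(2,3) associates_dvd_iff_left associates_dvd_iff_right associates_mult[OF _ associates_refl]
    unfolding stable_def by metis
qed

text \<open>Both sides are the product of the iterates with exponents 0 to \<open>Suc n\<close>,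
  with the last or the first factor written separately.\<close>

lemma prod_funpow_shift:
  assumes aut: "ring_automorphism \<sigma>"
  shows "(\<Prod>i=0..n. (\<sigma> ^^ i) r) * (\<sigma> ^^ Suc n) r = r * \<sigma> (\<Prod>i=0..n. (\<sigma> ^^ i) r)"
proof (induction n)
  case (Suc n)
  show ?case
    using arg_cong[OF Suc.IH, of "\<lambda>t. t * (\<sigma> ^^ Suc (Suc n)) r"]
    by (simp add: ring_automorphism_mult[OF aut] ac_simps)
qed simp

text \<open>Applying \<open>\<sigma>\<close> to a chain replaces its first factor \<open>r\<close>
  by the successor of its last factor, and that successor is associated to
  \<open>\<sigma> s\<close>. The two divisibilities are read off from this one identity.\<close>

lemma stable_chain_product:
  assumes aut: "ring_automorphism \<sigma>" and ex: "\<exists>n. associates s ((\<sigma> ^^ n) r)"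
  shows "stable \<sigma> s r (chain_product \<sigma> r s)"
proof -
  let ?c = "chain_product \<sigma> r s" and ?m = "chain_length \<sigma> r s"
  have shift: "?c * \<sigma> ((\<sigma> ^^ ?m) r) = r * \<sigma> ?c"
    using prod_funpow_shift[OF aut, where n = ?m and r = r] by (simp add: chain_product_def)
  have "associates (?c * \<sigma> s) (?c * \<sigma> ((\<sigma> ^^ ?m) r))"
    using chain_length_associates[OF ex]
    by (intro associates_mult) (simp_all add: ring_automorphism_associates_iff[OF aut])
  then have "\<sigma> ?c dvd ?c * \<sigma> s"
    using associates_dvd_iff_right shift by (metis dvd_triv_right)
  moreover have "?c dvd \<sigma> ?c * r"
    using shift by (metis dvd_triv_left mult.commute)
  ultimately show ?thesis by (simp add: stable_def)
qed

text \<open>Reindexed to start at exponent 0 with \<open>\<sigma> z\<close>, the orbit product has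
  the shape of \<open>prod_funpow_shift\<close>.\<close>

lemma full_orbit_product_eq:
  assumes "0 < card (Orb \<sigma> z)"
  shows "full_orbit_product \<sigma> z = (\<Prod>i=0..card (Orb \<sigma> z) - 1. (\<sigma> ^^ i) (\<sigma> z))"
proof -
  obtain N where "card (Orb \<sigma> z) = Suc N" using assms by (auto dest: gr0_implies_Suc)
  then show ?thesis
    unfolding full_orbit_product_def One_nat_def
    by (simp add: prod.atLeast_Suc_atMost_Suc_shift funpow_swap1 del: prod.cl_ivl_Suc)
qed

text \<open>The shift identity exchanges the first factor \<open>\<sigma> z\<close> for the
  successor of the last factor; by periodicity these are associated, and \<open>\<sigma> z\<close>
  cancels.\<close>

lemma associates_full_orbit_product:
  fixes \<sigma> :: "'a::{factorial_semiring, idom} \<Rightarrow> 'a"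
  assumes aut: "ring_automorphism \<sigma>" and z: "irreducible z" and fin: "finite (Orb \<sigma> z)"
  shows "associates (full_orbit_product \<sigma> z) (\<sigma> (full_orbit_product \<sigma> z))"
proof -
  let ?w = "full_orbit_product \<sigma> z" and ?D = "card (Orb \<sigma> z)"
  have D: "0 < ?D" "associates z ((\<sigma> ^^ ?D) z)" using card_Orb_period[OF aut fin] by auto
  have "\<sigma> ((\<sigma> ^^ ?D) z) = (\<sigma> ^^ Suc (?D - 1)) (\<sigma> z)"
    using D(1) by (simp add: funpow_swap1)
  then have "?w * \<sigma> ((\<sigma> ^^ ?D) z) = \<sigma> z * \<sigma> ?w"
    using prod_funpow_shift[OF aut, where n = "?D - 1" and r = "\<sigma> z"] by (simp only: full_orbit_product_eq[OF D(1)])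
  moreover have "associates (?w * \<sigma> z) (?w * \<sigma> ((\<sigma> ^^ ?D) z))"
    using D(2) by (intro associates_mult) (simp_all add: ring_automorphism_associates_iff[OF aut])
  ultimately have "associates (\<sigma> z * ?w) (\<sigma> z * \<sigma> ?w)" by (simp add: mult.commute)
  moreover have "\<sigma> z \<noteq> 0" using ring_automorphism_irreducible[OF aut z] by (auto simp: irreducible_def)
  ultimately show ?thesis by (simp add: associates_def)
qed

lemma chain_orbit_factorization_stable:
  fixes \<sigma> :: "'a::{factorial_semiring, idom} \<Rightarrow> 'a"
  assumes aut: "ring_automorphism \<sigma>" and fac: "chain_orbit_factorization \<sigma> p q g n qs ps m zs"
  shows "stable \<sigma> p q g"
proof -
  let ?c = "\<lambda>i. chain_product \<sigma> (qs i) (ps i)" and ?w = "\<lambda>j. full_orbit_product \<sigma> (zs j)"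
  have "stable \<sigma> (\<Prod>i=1..n. ps i) (\<Prod>i=1..n. qs i) (\<Prod>i=1..n. ?c i)"
    using fac by (intro stable_prod[OF aut] stable_chain_product[OF aut])
      (auto simp: chain_orbit_factorization_def basic_chain_def)
  \<comment> \<open>Full orbits are stable already for \<open>p = q = 1\<close>, so they use up no
    factor of \<open>p\<close> or \<open>q\<close>.\<close>
  moreover have "stable \<sigma> (\<Prod>j=1..m. 1) (\<Prod>j=1..m. 1) (\<Prod>j=1..m. ?w j)"
  proof (rule stable_prod[OF aut])
    fix j assume "j \<in> {1..m}"
    then have "associates (?w j) (\<sigma> (?w j))"
      using fac by (intro associates_full_orbit_product[OF aut]) (auto simp: chain_orbit_factorization_def)
    then show "stable \<sigma> 1 1 (?w j)" by (simp add: stable_def associates_def ring_automorphism_one[OF aut])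
  qed
  ultimately have "stable \<sigma> (\<Prod>i=1..n. ps i) (\<Prod>i=1..n. qs i) ((\<Prod>i=1..n. ?c i) * (\<Prod>j=1..m. ?w j))"
    using stable_mult[OF aut] by fastforce
  then show ?thesis
    using fac unfolding chain_orbit_factorization_def
    by (blast intro: stable_mono[OF aut] stable_associates[OF aut] associates_sym)
qed


section \<open>Maximal runs of divisors\<close>

text \<open>
  \<open>[r], \<dots>, [\<sigma>\<^sup>n r]\<close> is a maximal interval of the orbit of \<open>r\<close> inside the support of \<open>g\<close>;
  \<open>\<not> r dvd \<sigma> g\<close> says that \<open>\<sigma>\<^sup>-\<^sup>1 r\<close> does not divide \<open>g\<close>.
\<close>

definition maximal_run :: "('a::comm_semiring_1 \<Rightarrow> 'a) \<Rightarrow> 'a \<Rightarrow> 'a \<Rightarrow> nat \<Rightarrow> bool" where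
  "maximal_run \<sigma> g r n \<longleftrightarrow> irreducible r \<and> (\<forall>i\<le>n. (\<sigma> ^^ i) r dvd g) \<and>
     \<not> (\<sigma> ^^ Suc n) r dvd g \<and> \<not> r dvd \<sigma> g"

text \<open>If all iterates with exponent in \<open>I\<close> divided \<open>g\<close>, finiteness
  of the divisor classes would yield a period \<open>e\<close>, and some \<open>k + e * t\<close> in
  \<open>I\<close> would have the class of the non-divisor at \<open>k\<close>. The condition on
  \<open>I\<close> holds for both half-lines of integers.\<close>

lemma ex_int_iterate_not_dvd:
  fixes \<sigma> :: "'a::{factorial_semiring, idom} \<Rightarrow> 'a"
  assumes aut: "ring_automorphism \<sigma>" and g: "g \<noteq> 0" and z: "irreducible z"
    and k: "\<not> int_iterate \<sigma> k z dvd g"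
    and I: "infinite I" "\<And>e. 0 < e \<Longrightarrow> \<exists>t. k + e * t \<in> I"
  shows "\<exists>i\<in>I. \<not> int_iterate \<sigma> i z dvd g"
proof (rule ccontr)
  assume *: "\<not> ?thesis"
  have "(\<lambda>i. associate_class (int_iterate \<sigma> i z)) ` I \<subseteq> associate_class ` {r. irreducible r \<and> r dvd g}"
    using * irreducible_int_iterate[OF aut z] by blast
  then have "finite ((\<lambda>i. associate_class (int_iterate \<sigma> i z)) ` I)"
    using finite_irreducible_divisor_classes[OF g] by (rule finite_subset)
  then obtain e where e: "0 < e" "associates z (int_iterate \<sigma> e z)"
    using period_of_infinite[OF aut I(1)] by blast
  from I(2)[OF e(1)] obtain t where "k + e * t \<in> I" by blast
  then show False
    using * k associates_dvd_iff_left[OF associates_int_iterate_period[OF aut e(2), of k t]] by blast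
qed

text \<open>Starting at \<open>z\<close>, move along the orbit in both directions until divisibility
  of \<open>g\<close> first fails. A single failure anywhere in the orbit forces one on each
  side.\<close>

lemma maximal_run_exists:
  fixes \<sigma> :: "'a::{factorial_semiring, idom} \<Rightarrow> 'a"
  assumes aut: "ring_automorphism \<sigma>" and g: "g \<noteq> 0" and z: "irreducible z" "z dvd g"
    and k: "\<not> int_iterate \<sigma> k z dvd g"
  shows "\<exists>r n. maximal_run \<sigma> g r n"
proof -
  let ?Z = "\<lambda>i. int_iterate \<sigma> i z"
  \<comment> \<open>Hence adding or subtracting \<open>\<bar>k\<bar>\<close> periods moves
    \<open>k\<close> into the upper or the lower half-line.\<close>
  have bound: "\<bar>k\<bar> \<le> e * \<bar>k\<bar>" if "0 < e" for e
    using mult_right_mono[of 1 e "\<bar>k\<bar>"] that by simp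
  have "\<exists>i\<in>{0..}. \<not> ?Z i dvd g"
  proof (rule ex_int_iterate_not_dvd[OF aut g z(1) k])
    fix e :: int assume "0 < e"
    then have "0 \<le> k + e * \<bar>k\<bar>" using bound[of e] by linarith
    then show "\<exists>t. k + e * t \<in> {0..}" by (intro exI[of _ "\<bar>k\<bar>"]) simp
  qed (simp add: infinite_Ici)
  then have up: "\<exists>u. \<not> ?Z (int u) dvd g" by (metis atLeast_iff nonneg_int_cases)
  have "\<exists>i\<in>{..0}. \<not> ?Z i dvd g"
  proof (rule ex_int_iterate_not_dvd[OF aut g z(1) k])
    fix e :: int assume "0 < e"
    then have "k + e * - \<bar>k\<bar> \<le> 0" using bound[of e] by simp
    then show "\<exists>t. k + e * t \<in> {..0}" by (intro exI[of _ "- \<bar>k\<bar>"]) simp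
  qed (simp add: infinite_Iic)
  then have down: "\<exists>u. \<not> ?Z (- int u) dvd g" by (metis atMost_iff nonpos_int_cases)
  define U where "U = (LEAST u. \<not> ?Z (int u) dvd g)"
  define L where "L = (LEAST u. \<not> ?Z (- int u) dvd g)"
  have U: "\<not> ?Z (int U) dvd g" unfolding U_def by (rule LeastI_ex[OF up])
  have L: "\<not> ?Z (- int L) dvd g" unfolding L_def by (rule LeastI_ex[OF down])
  have "0 < U" "0 < L" using U L z(2) by (auto intro: Nat.gr0I)
  \<comment> \<open>The exponents \<open>- int L\<close> and \<open>int U\<close> are the first
    failures, so the run occupies \<open>1 - int L\<close> to \<open>int U - 1\<close>, which are
    \<open>U + L - 1\<close> classes; its last index counted from \<open>r\<close> is therefore
    \<open>U + L - 2\<close>.\<close>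
  define r where "r = ?Z (1 - int L)"
  define n where "n = U + L - 2"
  have pow: "(\<sigma> ^^ i) r = ?Z (1 - int L + int i)" for i
    by (simp add: r_def funpow_int_iterate[OF aut])
  have "(\<sigma> ^^ i) r dvd g" if "i \<le> n" for i
  \<comment> \<open>Minimality of \<open>U\<close> covers the nonnegative exponents and minimality
    of \<open>L\<close> the negative ones.\<close>
  proof (cases "0 \<le> 1 - int L + int i")
    case True
    then have "nat (1 - int L + int i) < U" using that \<open>0 < U\<close> \<open>0 < L\<close> unfolding n_def by linarith
    with True show ?thesis using not_less_Least[of "nat (1 - int L + int i)" "\<lambda>u. \<not> ?Z (int u) dvd g"]
      unfolding pow U_def by simp
  next
    case False
    then have "nat (- (1 - int L + int i)) < L" using that \<open>0 < L\<close> by linarith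
    then have "?Z (- int (nat (- (1 - int L + int i)))) dvd g"
      using not_less_Least unfolding L_def by blast
    moreover have "- int (nat (- (1 - int L + int i))) = 1 - int L + int i" using False by linarith
    ultimately show ?thesis unfolding pow by (simp only:)
  qed
  moreover have "1 - int L + int (Suc n) = int U" using \<open>0 < U\<close> \<open>0 < L\<close> by (simp add: n_def)
  then have "\<not> (\<sigma> ^^ Suc n) r dvd g" unfolding pow using U by simp
  moreover have "r = \<sigma> (?Z (- int L))" by (simp add: r_def int_iterate_step[OF aut])
  then have "\<not> r dvd \<sigma> g" using L by (simp add: ring_automorphism_dvd_iff[OF aut])
  moreover have "irreducible r"
    unfolding r_def by (rule irreducible_int_iterate[OF aut z(1)])
  ultimately have "maximal_run \<sigma> g r n" unfolding maximal_run_def by blast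
  then show ?thesis by blast
qed

section \<open>Splitting off a maximal run\<close>

context
  fixes \<sigma> :: "'a::{factorial_semiring, idom} \<Rightarrow> 'a" and g r :: 'a and n :: nat
  assumes aut: "ring_automorphism \<sigma>" and run: "maximal_run \<sigma> g r n"
begin

lemma maximal_run_irreducible: "irreducible ((\<sigma> ^^ i) r)"
  using run irreducible_funpow[OF aut] by (auto simp: maximal_run_def)

lemma maximal_run_dvd: "i \<le> n \<Longrightarrow> (\<sigma> ^^ i) r dvd g"
  using run by (simp add: maximal_run_def)

text \<open>Shifting a repetition up to index \<open>Suc n\<close> would associate the non-divisor
  there to an earlier element of the run, which divides \<open>g\<close>. Index \<open>Suc n\<close>
  is included for the orbit count in \<open>basic_chain_maximal_run\<close>.\<close>

lemma maximal_run_distinct: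
  assumes "i < j" "j \<le> Suc n"
  shows "\<not> associates ((\<sigma> ^^ i) r) ((\<sigma> ^^ j) r)"
proof
  assume "associates ((\<sigma> ^^ i) r) ((\<sigma> ^^ j) r)"
  then have "associates ((\<sigma> ^^ (Suc n - j)) ((\<sigma> ^^ i) r)) ((\<sigma> ^^ (Suc n - j)) ((\<sigma> ^^ j) r))"
    by (simp add: ring_automorphism_associates_iff[OF ring_automorphism_funpow[OF aut]])
  then have "associates ((\<sigma> ^^ (Suc n - j + i)) r) ((\<sigma> ^^ (Suc n - j + j)) r)"
    unfolding funpow_add comp_def .
  moreover have "(\<sigma> ^^ (Suc n - j + i)) r dvd g"
    using run assms by (simp add: maximal_run_def)
  ultimately have "(\<sigma> ^^ Suc n) r dvd g"
    using assms(2) associates_dvd_iff_left by (metis le_add_diff_inverse2)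
  then show False using run by (simp add: maximal_run_def)
qed

text \<open>As no class repeats, the end of the run is first reached at step \<open>n\<close>, so
  the chain product of its end points is the product of the whole run.\<close>

lemma chain_length_maximal_run: "chain_length \<sigma> r ((\<sigma> ^^ n) r) = n"
  unfolding chain_length_def
proof (rule Least_equality)
  fix i assume "associates ((\<sigma> ^^ n) r) ((\<sigma> ^^ i) r)"
  then have "\<not> i < n" using maximal_run_distinct[of i n] associates_sym le_SucI by blast
  then show "n \<le> i" by simp
qed simp

lemma basic_chain_maximal_run:
  assumes "stable \<sigma> p q g"
  shows "basic_chain \<sigma> p q r ((\<sigma> ^^ n) r)"
  unfolding basic_chain_def chain_length_maximal_run
proof (intro conjI impI)
  show "irreducible r" "irreducible ((\<sigma> ^^ n) r)"
    using maximal_run_irreducible[of 0] maximal_run_irreducible[of n] by simp_all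
  \<comment> \<open>The prime \<open>r\<close> divides \<open>g\<close>, hence
    \<open>\<sigma> g * q\<close>, but not \<open>\<sigma> g\<close>; so it divides
    \<open>q\<close>. The argument at the upper end is symmetric, with
    \<open>g * \<sigma> p\<close>.\<close>
  have "r dvd \<sigma> g * q"
    using dvd_trans[of r g] maximal_run_dvd[of 0] assms by (simp add: stable_def)
  then show "r dvd q"
    using run prime_elem_dvd_multD[OF irreducible_imp_prime_elem, of r "\<sigma> g" q]
    unfolding maximal_run_def by blast
  have "\<sigma> ((\<sigma> ^^ n) r) dvd \<sigma> g"
    using run by (simp add: maximal_run_def ring_automorphism_dvd_iff[OF aut])
  then have "\<sigma> ((\<sigma> ^^ n) r) dvd g * \<sigma> p"
    using assms unfolding stable_def by (blast intro: dvd_trans)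
  then have "\<sigma> ((\<sigma> ^^ n) r) dvd \<sigma> p"
    using run prime_elem_dvd_multD[OF irreducible_imp_prime_elem[OF maximal_run_irreducible[of "Suc n"]], of g "\<sigma> p"]
    unfolding maximal_run_def funpow.simps comp_def by blast
  then show "(\<sigma> ^^ n) r dvd p" by (simp add: ring_automorphism_dvd_iff[OF aut])
  show "\<exists>i. associates ((\<sigma> ^^ n) r) ((\<sigma> ^^ i) r)" by (blast intro: associates_refl)
  assume fin: "finite (Orb \<sigma> r)"
  let ?C = "\<lambda>i. associate_class ((\<sigma> ^^ i) r)"
  \<comment> \<open>The run together with the non-divisor following it gives \<open>n + 2\<close>
    distinct classes, so the run cannot exhaust a finite orbit.\<close>
  have "inj_on ?C {0..Suc n}"
    by (intro linorder_inj_onI') (simp add: associate_class_eq_iff maximal_run_distinct del: funpow.simps)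
  then have "card (?C ` {0..Suc n}) = n + 2" by (simp add: card_image)
  moreover have "?C ` {0..Suc n} \<subseteq> Orb \<sigma> r"
    by (auto simp: Orb_def simp flip: int_iterate_of_nat)
  ultimately show "n + 1 < card (Orb \<sigma> r)"
    using card_mono[OF fin, of "?C ` {0..Suc n}"] by linarith
qed

lemma chain_product_maximal_run_dvd: "chain_product \<sigma> r ((\<sigma> ^^ n) r) dvd g"
  by (rule chain_product_dvd[OF aut])
     (use maximal_run_irreducible[of 0] maximal_run_dvd in
       \<open>auto simp: chain_length_maximal_run intro: exI[of _ n]\<close>)

text \<open>The shift identity cancels the chain from both conditions, except for a surplus factor
  \<open>?s\<close> in one and \<open>r\<close> in the other. By maximality \<open>?s\<close> does
  not divide \<open>h\<close> and \<open>r\<close> does not divide \<open>\<sigma> h\<close>, so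
  these primes cancel as well.\<close>

lemma stable_quotient_maximal_run:
  assumes st: "stable \<sigma> ((\<sigma> ^^ n) r * p) (r * q) g" and g: "g = chain_product \<sigma> r ((\<sigma> ^^ n) r) * h"
    and "g \<noteq> 0"
  shows "stable \<sigma> p q h"
proof -
  let ?c = "chain_product \<sigma> r ((\<sigma> ^^ n) r)" and ?s = "(\<sigma> ^^ Suc n) r"
  have shift: "?c * ?s = r * \<sigma> ?c"
    using prod_funpow_shift[OF aut, where n = n and r = r] by (simp add: chain_product_def chain_length_maximal_run)
  have c: "?c \<noteq> 0" "h \<noteq> 0" using assms(3) by (auto simp: g)
  have sc: "\<sigma> ?c \<noteq> 0"
    using c(1) shift maximal_run_irreducible[of "Suc n"] unfolding irreducible_def
    by (metis mult_eq_0_iff)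
  have s: "\<not> ?s dvd h" and r: "\<not> r dvd \<sigma> h"
    using run dvd_mult[of _ h ?c] dvd_mult[of _ "\<sigma> h" "\<sigma> ?c"]
    unfolding maximal_run_def g ring_automorphism_mult[OF aut] by blast+
  have "?c * h dvd \<sigma> (?c * h) * (r * q)" using st unfolding stable_def g by blast
  also have "\<sigma> (?c * h) * (r * q) = r * \<sigma> ?c * (\<sigma> h * q)"
    by (simp only: ring_automorphism_mult[OF aut] ac_simps)
  also have "\<dots> = ?c * (?s * (\<sigma> h * q))" by (simp only: shift[symmetric] ac_simps)
  finally have "h dvd ?s * (\<sigma> h * q)" using c by simp
  then have "h dvd \<sigma> h * q" by (rule dvd_cancel_irreducible[OF maximal_run_irreducible s])
  have "\<sigma> (?c * h) dvd ?c * h * \<sigma> ((\<sigma> ^^ n) r * p)" using st unfolding stable_def g by blast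
  also have "?c * h * \<sigma> ((\<sigma> ^^ n) r * p) = ?c * ?s * (h * \<sigma> p)"
    by (simp add: ring_automorphism_mult[OF aut] mult_ac)
  also have "\<dots> = \<sigma> ?c * (r * (h * \<sigma> p))" by (subst shift) (simp only: ac_simps)
  finally have "\<sigma> h dvd r * (h * \<sigma> p)" using sc by (simp add: ring_automorphism_mult[OF aut])
  moreover have "irreducible r" using maximal_run_irreducible[of 0] by simp
  ultimately have "\<sigma> h dvd h * \<sigma> p" using r dvd_cancel_irreducible by blast
  with \<open>h dvd \<sigma> h * q\<close> show ?thesis by (simp add: stable_def)
qed

text \<open>
  Once a factor of the second chain is associated to one of the run, its neighbours along the
  second chain stay in the run, since they divide \<open>g\<close>.
\<close>

lemma maximal_run_coprime_or_dvd:
  assumes s: "irreducible s" and ex: "\<exists>k. associates t ((\<sigma> ^^ k) s)" and d: "chain_product \<sigma> s t dvd g"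
  shows "coprime (chain_product \<sigma> r ((\<sigma> ^^ n) r)) (chain_product \<sigma> s t) \<or>
    chain_product \<sigma> s t dvd chain_product \<sigma> r ((\<sigma> ^^ n) r)"
proof (cases "coprime (chain_product \<sigma> r ((\<sigma> ^^ n) r)) (chain_product \<sigma> s t)")
  case False
  let ?c = "chain_product \<sigma> r ((\<sigma> ^^ n) r)" and ?d = "chain_product \<sigma> s t"
    and ?m = "chain_length \<sigma> s t"
  have irr: "irreducible ((\<sigma> ^^ k) s)" for k
    by (rule irreducible_funpow[OF aut s])
  have dvd_g: "(\<sigma> ^^ k) s dvd g" if "k \<le> ?m" for k
    using funpow_dvd_chain_product[OF that] d by (rule dvd_trans)
  have "?c \<noteq> 0"
    using maximal_run_irreducible by (auto simp: chain_product_def irreducible_def)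
  \<comment> \<open>A common prime divisor \<open>w\<close> divides one factor of each chain, which
    makes these two factors associated: the chains meet.\<close>
  obtain b where b: "b dvd ?c" "b dvd ?d" "\<not> is_unit b" using False by (auto simp: coprime_def)
  moreover have "b \<noteq> 0" using b(1) \<open>?c \<noteq> 0\<close> by auto
  ultimately obtain w where w: "w dvd b" "prime w" using prime_divisor_exists by blast
  then have wi: "irreducible w" using prime_elem_imp_irreducible by blast
  obtain i where i: "i \<le> n" "w dvd (\<sigma> ^^ i) r"
    using irreducible_dvd_prodD[OF wi, of "{0..n}" "\<lambda>i. (\<sigma> ^^ i) r"] dvd_trans[OF w(1) b(1)]
    by (auto simp: chain_product_def chain_length_maximal_run)
  obtain l where l: "l \<le> ?m" "w dvd (\<sigma> ^^ l) s"
    using irreducible_dvd_prodD[OF wi, of "{0..?m}" "\<lambda>i. (\<sigma> ^^ i) s"] dvd_trans[OF w(1) b(2)]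
    by (auto simp: chain_product_def)
  have "associates ((\<sigma> ^^ l) s) ((\<sigma> ^^ i) r)"
    using irreducible_dvd_associates[OF wi] i(2) l(2) maximal_run_irreducible irr
    by (blast intro: associates_sym associates_trans)
  then have meet: "\<exists>i\<le>n. associates ((\<sigma> ^^ l) s) ((\<sigma> ^^ i) r)" using i(1) by blast
  have "\<exists>i\<le>n. associates ((\<sigma> ^^ k) s) ((\<sigma> ^^ i) r)" if "k \<le> ?m" for k
  proof (cases "l \<le> k")
    case True
    then show ?thesis using that
    proof (induction k rule: dec_induct)
      case (step k)
      then obtain i where i: "i \<le> n" "associates ((\<sigma> ^^ k) s) ((\<sigma> ^^ i) r)" by auto
      then have as: "associates ((\<sigma> ^^ Suc k) s) ((\<sigma> ^^ Suc i) r)"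
        by (simp add: ring_automorphism_associates_iff[OF aut])
      then have "(\<sigma> ^^ Suc i) r dvd g"
        using dvd_g[OF step.prems] associates_dvd_iff_left by blast
      \<comment> \<open>Going up, the second chain cannot leave the run at its top, because the next
        iterate does not divide \<open>g\<close>.\<close>
      then have "i \<noteq> n" using run by (auto simp: maximal_run_def)
      then show ?case using as i(1) by (metis Suc_leI le_neq_implies_less)
    qed (rule meet)
  next
    case False
    then have "k \<le> l" by simp
    then show ?thesis
    proof (induction k rule: inc_induct)
      case (step k)
      then obtain i where i: "i \<le> n" "associates ((\<sigma> ^^ Suc k) s) ((\<sigma> ^^ i) r)" by auto
      show ?case
      proof (cases i)
        case 0
        \<comment> \<open>Going down past \<open>r\<close> would need a predecessor of
          \<open>r\<close> that divides \<open>g\<close>, that is,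
          \<open>r dvd \<sigma> g\<close>.\<close>
        have "(\<sigma> ^^ Suc k) s dvd \<sigma> g"
          using dvd_g[of k] step.hyps l(1) by (simp add: ring_automorphism_dvd_iff[OF aut])
        then have "r dvd \<sigma> g" using i(2) 0 associates_dvd_iff_left by auto
        then show ?thesis using run by (simp add: maximal_run_def)
      next
        case (Suc i')
        then show ?thesis using i by (auto simp: ring_automorphism_associates_iff[OF aut] intro!: exI[of _ i'])
      qed
    qed (rule meet)
  qed
  then have "(\<sigma> ^^ k) s dvd ?c" if "k \<le> ?m" for k
    using that funpow_dvd_chain_product[of _ \<sigma> r "(\<sigma> ^^ n) r"] associates_dvd_iff_left
    unfolding chain_length_maximal_run by metis
  then have "?d dvd ?c" by (rule chain_product_dvd[OF aut s ex])
  then show ?thesis ..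
qed simp

end


section \<open>Nested factorizations\<close>

text \<open>The extra conditions on the choice of chains, bundled so that the induction can carry
  them.\<close>

definition nested_chains :: "('a::algebraic_semidom \<Rightarrow> 'a) \<Rightarrow> nat \<Rightarrow> (nat \<Rightarrow> 'a) \<Rightarrow> (nat \<Rightarrow> 'a) \<Rightarrow> bool" where
  "nested_chains \<sigma> n qs ps \<longleftrightarrow>
     (\<forall>i\<in>{1..n}. \<forall>j\<in>{1..n}. \<not> associates (\<sigma> (ps i)) (qs j)) \<and>
     (\<forall>i\<in>{1..n}. \<forall>j\<in>{1..n}.
        coprime (chain_product \<sigma> (qs i) (ps i)) (chain_product \<sigma> (qs j) (ps j)) \<or>
        chain_product \<sigma> (qs i) (ps i) dvd chain_product \<sigma> (qs j) (ps j) \<or>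
        chain_product \<sigma> (qs j) (ps j) dvd chain_product \<sigma> (qs i) (ps i))"

lemma chain_orbit_factorization_add_orbit:
  assumes "chain_orbit_factorization \<sigma> p q g n qs ps m zs" "irreducible z" "finite (Orb \<sigma> z)"
  shows "chain_orbit_factorization \<sigma> p q (full_orbit_product \<sigma> z * g) n qs ps (Suc m) (zs(Suc m := z))"
proof -
  have "(\<Prod>j=1..m. full_orbit_product \<sigma> ((zs(Suc m := z)) j)) = (\<Prod>j=1..m. full_orbit_product \<sigma> (zs j))"
    by (rule prod.cong) auto
  then have prods: "(\<Prod>j=1..Suc m. full_orbit_product \<sigma> ((zs(Suc m := z)) j)) =
      full_orbit_product \<sigma> z * (\<Prod>j=1..m. full_orbit_product \<sigma> (zs j))"
    by (simp add: mult.commute)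
  have "associates (full_orbit_product \<sigma> z * g)
    (full_orbit_product \<sigma> z * ((\<Prod>i=1..n. chain_product \<sigma> (qs i) (ps i)) * (\<Prod>j=1..m. full_orbit_product \<sigma> (zs j))))"
    using assms(1) unfolding chain_orbit_factorization_def by (blast intro: associates_mult associates_refl)
  then have "associates (full_orbit_product \<sigma> z * g)
    ((\<Prod>i=1..n. chain_product \<sigma> (qs i) (ps i)) * (\<Prod>j=1..Suc m. full_orbit_product \<sigma> ((zs(Suc m := z)) j)))"
    unfolding prods by (simp only: mult.left_commute)
  moreover have "irreducible ((zs(Suc m := z)) j) \<and> finite (Orb \<sigma> ((zs(Suc m := z)) j))"
    if "j \<in> {1..Suc m}" for j
    using that assms by (auto simp: chain_orbit_factorization_def)
  ultimately show ?thesis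
    using assms(1) unfolding chain_orbit_factorization_def by blast
qed

lemma chain_orbit_factorization_add_chain:
  fixes \<sigma> :: "'a::comm_semiring_1 \<Rightarrow> 'a"
  assumes fac: "chain_orbit_factorization \<sigma> p q g n qs ps m zs"
    and chain: "basic_chain \<sigma> (p0 * p) (q0 * q) q0 p0"
  shows "chain_orbit_factorization \<sigma> (p0 * p) (q0 * q) (chain_product \<sigma> q0 p0 * g)
    (Suc n) (qs(Suc n := q0)) (ps(Suc n := p0)) m zs"
proof -
  let ?qs = "qs(Suc n := q0)" and ?ps = "ps(Suc n := p0)"
  have prods: "(\<Prod>i=1..n. ?qs i) = (\<Prod>i=1..n. qs i)" "(\<Prod>i=1..n. ?ps i) = (\<Prod>i=1..n. ps i)"
    "(\<Prod>i=1..n. chain_product \<sigma> (?qs i) (?ps i)) = (\<Prod>i=1..n. chain_product \<sigma> (qs i) (ps i))"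
    by (auto intro!: prod.cong)
  have Suc: "(\<Prod>i=1..Suc n. f i) = f (Suc n) * (\<Prod>i=1..n. f i)" for f :: "nat \<Rightarrow> 'a"
    by (simp add: mult.commute)
  \<comment> \<open>Earlier chains stay basic, since \<open>p\<close> and \<open>q\<close> are only
    replaced by multiples.\<close>
  have "basic_chain \<sigma> (p0 * p) (q0 * q) (?qs i) (?ps i)" if "i \<in> {1..Suc n}" for i
    using that fac chain by (auto simp: chain_orbit_factorization_def basic_chain_def)
  moreover have "(\<Prod>i=1..Suc n. ?qs i) dvd q0 * q" "(\<Prod>i=1..Suc n. ?ps i) dvd p0 * p"
    using fac mult_dvd_mono[OF dvd_refl, of _ q q0] mult_dvd_mono[OF dvd_refl, of _ p p0]
    unfolding Suc prods
    by (simp_all add: chain_orbit_factorization_def)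
  moreover have "associates (chain_product \<sigma> q0 p0 * g)
    (chain_product \<sigma> q0 p0 * ((\<Prod>i=1..n. chain_product \<sigma> (qs i) (ps i)) * (\<Prod>j=1..m. full_orbit_product \<sigma> (zs j))))"
    using fac unfolding chain_orbit_factorization_def by (blast intro: associates_mult associates_refl)
  then have "associates (chain_product \<sigma> q0 p0 * g)
    ((\<Prod>i=1..Suc n. chain_product \<sigma> (?qs i) (?ps i)) * (\<Prod>j=1..m. full_orbit_product \<sigma> (zs j)))"
    unfolding Suc prods by (simp add: mult.assoc)
  ultimately show ?thesis
    using fac by (simp only: chain_orbit_factorization_def) blast
qed

text \<open>The induction has to vary \<open>p\<close> and \<open>q\<close> along with
  \<open>g\<close>, because splitting off a chain divides each of them by an end point of that
  chain.\<close>

lemma stable_nested_factorization: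
  fixes \<sigma> :: "'a::{factorial_semiring, idom} \<Rightarrow> 'a"
  assumes aut: "ring_automorphism \<sigma>" and "g \<noteq> 0" "stable \<sigma> p q g"
  shows "\<exists>n qs ps m zs. chain_orbit_factorization \<sigma> p q g n qs ps m zs \<and> nested_chains \<sigma> n qs ps"
  using assms(2,3)
proof (induction "size (prime_factorization g)" arbitrary: g p q rule: less_induct)
  case less
  have smaller: "size (prime_factorization h) < size (prime_factorization g)"
    if "g = c * h" "\<not> is_unit c" for c h
    using less.prems(1) that
    by (simp add: prime_factorization_mult prime_factorization_empty_iff nonempty_has_size[symmetric])
  \<comment> \<open>A nonunit has an irreducible divisor; either its whole orbit divides
    \<open>g\<close>, or some iterate does not and a maximal run exists.\<close>
  consider (unit) "is_unit g"
    | (orbit) z where "irreducible z" "\<And>k. int_iterate \<sigma> k z dvd g"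
    | (run) r n where "maximal_run \<sigma> g r n"
    using prime_divisor_exists[OF less.prems(1)] maximal_run_exists[OF aut less.prems(1)]
    by (metis prime_imp_prime_elem prime_elem_imp_irreducible)
  then show ?case
  proof cases
    case unit
    \<comment> \<open>Both products are empty, so the values of the index functions are
      arbitrary.\<close>
    then have "chain_orbit_factorization \<sigma> p q g 0 undefined undefined 0 undefined"
      by (simp add: chain_orbit_factorization_def associates_def)
    moreover have "nested_chains \<sigma> 0 undefined undefined" by (simp add: nested_chains_def)
    ultimately show ?thesis by blast
  next
    case orbit
    let ?w = "full_orbit_product \<sigma> z"
    have irr: "irreducible (int_iterate \<sigma> k z)" for k
      by (rule irreducible_int_iterate[OF aut orbit(1)])
    \<comment> \<open>An orbit that consists of divisors of a nonzero element is finite.\<close>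
    have "Orb \<sigma> z \<subseteq> associate_class ` {r. irreducible r \<and> r dvd g}"
      using orbit(2) irr by (auto simp: Orb_def)
    then have fin: "finite (Orb \<sigma> z)"
      using finite_irreducible_divisor_classes[OF less.prems(1)] by (rule finite_subset)
    have "?w dvd g"
      unfolding full_orbit_product_def
      by (rule prod_distinct_irreducibles_dvd)
         (use card_Orb_period[OF aut fin] irr[of "int _"] orbit(2)[of "int _"] in \<open>auto simp: int_iterate_of_nat\<close>)
    then obtain h where h: "g = ?w * h" by (rule dvdE)
    have nz: "?w \<noteq> 0" "h \<noteq> 0" using less.prems(1) h by auto
    have "(\<sigma> ^^ 1) z dvd ?w"
      unfolding full_orbit_product_def using card_Orb_period(2)[OF aut fin]
      by (intro dvd_prod_eqI[of _ 1]) auto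
    then have "\<not> is_unit ?w"
      using irr[of 1] by (auto simp: irreducible_def int_iterate_def intro: dvd_trans)
    have w: "associates ?w (\<sigma> ?w)" by (rule associates_full_orbit_product[OF aut orbit(1) fin])
    have "stable \<sigma> p q h"
    proof -
      \<comment> \<open>As \<open>?w\<close> and \<open>\<sigma> ?w\<close> are associated, the
        orbit cancels from both conditions and \<open>p\<close>, \<open>q\<close> remain
        unchanged.\<close>
      have "?w * h dvd \<sigma> ?w * (\<sigma> h * q)" "\<sigma> ?w * \<sigma> h dvd ?w * (h * \<sigma> p)"
        using less.prems(2) by (simp_all add: stable_def h ring_automorphism_mult[OF aut] mult.assoc)
      moreover have "\<sigma> ?w * (\<sigma> h * q) dvd ?w * (\<sigma> h * q)" "?w * \<sigma> h dvd \<sigma> ?w * \<sigma> h"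
        using w by (simp_all add: associates_def mult_dvd_mono)
      ultimately have "?w * h dvd ?w * (\<sigma> h * q)" "?w * \<sigma> h dvd ?w * (h * \<sigma> p)"
        by (blast intro: dvd_trans)+
      then show ?thesis using nz by (simp add: stable_def)
    qed
    then show ?thesis
      using less.hyps[OF smaller[OF h \<open>\<not> is_unit ?w\<close>] nz(2)]
        chain_orbit_factorization_add_orbit[OF _ orbit(1) fin] h by metis
  next
    case run
    let ?p0 = "(\<sigma> ^^ n) r" and ?c = "chain_product \<sigma> r ((\<sigma> ^^ n) r)"
    note chain = basic_chain_maximal_run[OF aut run less.prems(2)]
    obtain p' q' where pq: "p = ?p0 * p'" "q = r * q'"
      using chain unfolding basic_chain_def by (metis dvdE)
    obtain h where h: "g = ?c * h" using chain_product_maximal_run_dvd[OF aut run] by (rule dvdE)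
    have "h \<noteq> 0" using less.prems(1) h by auto
    have "r dvd ?c" using funpow_dvd_chain_product[of 0 \<sigma> r ?p0] by simp
    then have "\<not> is_unit ?c"
      using chain by (auto simp: basic_chain_def irreducible_def intro: dvd_trans)
    moreover have "stable \<sigma> p' q' h"
      using stable_quotient_maximal_run[OF aut run _ h less.prems(1)] less.prems(2) pq by blast
    ultimately obtain k qs ps m zs
      where fac: "chain_orbit_factorization \<sigma> p' q' h k qs ps m zs" and nested: "nested_chains \<sigma> k qs ps"
      using less.hyps[OF smaller[OF h] \<open>h \<noteq> 0\<close>] by blast
    let ?qs = "qs(Suc k := r)" and ?ps = "ps(Suc k := ?p0)"
    have "chain_orbit_factorization \<sigma> p q g (Suc k) ?qs ?ps m zs"
      using chain_orbit_factorization_add_chain[OF fac] chain unfolding pq h by blast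
    moreover have "nested_chains \<sigma> (Suc k) ?qs ?ps"
    proof -
      \<comment> \<open>The chains from the induction divide \<open>h\<close>, hence
        \<open>g\<close>, so the maximality of the run with respect to \<open>g\<close> applies to
        them.\<close>
      have old: "irreducible (qs i) \<and> (\<exists>l. associates (ps i) ((\<sigma> ^^ l) (qs i))) \<and>
        chain_product \<sigma> (qs i) (ps i) dvd g" if "i \<in> {1..k}" for i
      proof -
        have "chain_product \<sigma> (qs i) (ps i) dvd (\<Prod>i=1..k. chain_product \<sigma> (qs i) (ps i))"
          using that by (intro dvd_prod_eqI[of _ i]) auto
        then have "chain_product \<sigma> (qs i) (ps i) dvd h"
          using fac by (auto simp: chain_orbit_factorization_def associates_def intro: dvd_trans dvd_mult2)
        then show ?thesis
          using that fac by (auto simp: h chain_orbit_factorization_def basic_chain_def)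
      qed
      have old_q: "qs i dvd g" if "i \<in> {1..k}" for i
        using funpow_dvd_chain_product[of 0 \<sigma> "qs i" "ps i"] old[OF that] by (auto intro: dvd_trans)
      have old_p: "ps i dvd g" if "i \<in> {1..k}" for i
        using funpow_dvd_chain_product[OF order_refl, of \<sigma> "qs i" "ps i"] old[OF that]
          associates_dvd_iff_left[OF chain_length_associates[of "ps i" \<sigma> "qs i"]]
        by (auto intro: dvd_trans)
      have top: "\<not> (\<sigma> ^^ Suc n) r dvd g" and bottom: "\<not> r dvd \<sigma> g" and r: "r dvd g"
        using run by (auto simp: maximal_run_def dest!: spec[of _ 0])
      \<comment> \<open>No chain continues another: one starting right above the run would
        contradict its maximality at the top, and one ending right below \<open>r\<close> its
        maximality at the bottom.\<close>
      have 1: "\<not> associates (\<sigma> ?p0) (qs i)" if "i \<in> {1..k}" for i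
        using top old_q[OF that] associates_dvd_iff_left[of "\<sigma> ?p0" "qs i" g] by auto
      have 2: "\<not> associates (\<sigma> ?p0) r"
        using top r associates_dvd_iff_left[of "\<sigma> ?p0" r g] by auto
      have 3: "\<not> associates (\<sigma> (ps i)) r" if "i \<in> {1..k}" for i
        using bottom old_p[OF that] associates_dvd_iff_left[of "\<sigma> (ps i)" r "\<sigma> g"]
        by (auto simp: ring_automorphism_dvd_iff[OF aut])
      have 4: "coprime ?c (chain_product \<sigma> (qs i) (ps i)) \<or> chain_product \<sigma> (qs i) (ps i) dvd ?c"
        if "i \<in> {1..k}" for i
        using maximal_run_coprime_or_dvd[OF aut run] old[OF that] by blast
      have "i = Suc k \<or> i \<in> {1..k}" if "i \<in> {1..Suc k}" for i using that by auto
      then show ?thesis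
        using nested 1 2 3 4 unfolding nested_chains_def
        by (smt (verit) fun_upd_apply coprime_commute dvd_refl atLeastAtMost_iff not_less_eq_eq)
    qed
    ultimately show ?thesis by blast
  qed
qed

theorem theorem2p8:
  fixes \<sigma> :: "'a::{factorial_semiring, idom} \<Rightarrow> 'a" and a p q :: 'a
  assumes "ring_automorphism \<sigma>" and "a \<noteq> 0" and "p dvd a" and "q = \<sigma> (a div p)"
  shows "{H. submodule H (GWA \<sigma> a) (V_module \<sigma> a p) \<and> (\<exists>g. H = R_span g)} =
         {R_span g | g. g = 0 \<or>
            (\<exists>n qs ps m zs. chain_orbit_factorization \<sigma> p q g n qs ps m zs)} \<and>
    (\<forall>g. g \<noteq> 0 \<and> (\<exists>n qs ps m zs. chain_orbit_factorization \<sigma> p q g n qs ps m zs) \<longrightarrow>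
      (\<exists>n qs ps m zs. chain_orbit_factorization \<sigma> p q g n qs ps m zs \<and>
         (\<forall>i\<in>{1..n}. \<forall>j\<in>{1..n}. \<not> associates (\<sigma> (ps i)) (qs j)) \<and>
         (\<forall>i\<in>{1..n}. \<forall>j\<in>{1..n}.
            coprime (chain_product \<sigma> (qs i) (ps i)) (chain_product \<sigma> (qs j) (ps j)) \<or>
            chain_product \<sigma> (qs i) (ps i) dvd chain_product \<sigma> (qs j) (ps j) \<or>
            chain_product \<sigma> (qs j) (ps j) dvd chain_product \<sigma> (qs i) (ps i))))"
proof -
  note aut = assms(1)
  have submodule_iff: "submodule (R_span g) (GWA \<sigma> a) (V_module \<sigma> a p) \<longleftrightarrow> stable \<sigma> p q g" for g
    using submodule_R_span_iff[OF aut assms(3)] assms(4) by simp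
  \<comment> \<open>Zero is stable trivially; for nonzero \<open>g\<close> the two directions are
    the stability of factorizations and the induction above.\<close>
  have stable_iff: "stable \<sigma> p q g \<longleftrightarrow>
    g = 0 \<or> (\<exists>n qs ps m zs. chain_orbit_factorization \<sigma> p q g n qs ps m zs)" for g
    using chain_orbit_factorization_stable[OF aut] stable_nested_factorization[OF aut]
    by (metis stable_def ring_automorphism_zero[OF aut] mult_zero_left dvd_refl)
  show ?thesis
  proof (intro conjI allI impI)
    show "{H. submodule H (GWA \<sigma> a) (V_module \<sigma> a p) \<and> (\<exists>g. H = R_span g)} =
      {R_span g | g. g = 0 \<or> (\<exists>n qs ps m zs. chain_orbit_factorization \<sigma> p q g n qs ps m zs)}"
      unfolding stable_iff[symmetric] submodule_iff[symmetric] by blast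
    fix g assume "g \<noteq> 0 \<and> (\<exists>n qs ps m zs. chain_orbit_factorization \<sigma> p q g n qs ps m zs)"
    then show "\<exists>n qs ps m zs. chain_orbit_factorization \<sigma> p q g n qs ps m zs \<and>
         (\<forall>i\<in>{1..n}. \<forall>j\<in>{1..n}. \<not> associates (\<sigma> (ps i)) (qs j)) \<and>
         (\<forall>i\<in>{1..n}. \<forall>j\<in>{1..n}.
            coprime (chain_product \<sigma> (qs i) (ps i)) (chain_product \<sigma> (qs j) (ps j)) \<or>
            chain_product \<sigma> (qs i) (ps i) dvd chain_product \<sigma> (qs j) (ps j) \<or>
            chain_product \<sigma> (qs j) (ps j) dvd chain_product \<sigma> (qs i) (ps i))"
      \<comment> \<open>The given factorization serves only to show that \<open>g\<close> is stable;
        the nested chains are then constructed afresh.\<close>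
      using stable_nested_factorization[OF aut, of g p q] stable_iff[of g]
      unfolding nested_chains_def by blast
  qed
qed

end
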